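(* Let $\mathcal{X}$ be a finite field with $q$ elements, let $W:\mathcal{X}\to\mathcal{Y}$ be a discrete memoryless channel, and let $G$ be an $\ell\times\ell$ full-rank lower triangular matrix over $\mathcal{X}$ (rows and columns indexed by $0,\dots,\ell-1$) which is not diagonal. Let the kernel be the linear map $g(u_0^{\ell-1})=u_0^{\ell-1}G$. Let $k$ be the largest index such that the number of non-zero elements in the $k$-th row of $G$ is larger than $1$. If there exists $j\in\{0,\dots,k-1\}$ such that $G_{kj}/G_{kk}$ is a primitive element of $\mathcal{X}$ (a generator of the multiplicative group of $\mathcal{X}$), then $P(I_\infty\in\{0,1\})=1$, where $I_\infty$ is the almost sure limit of $I(W^{(B_1)\cdots(B_n)})$ as $n\to\infty$.
   Context: Notation: $u_i^j=(u_i,\dots,u_j)$ denotes a row vector. A discrete memoryless channel (DMC) $W:\mathcal{X}\to\mathcal{Y}$ with finite input alphabet $\mathcal{X}$, $|\mathcal{X}|=q$, and at most countable output alphabet $\mathcal{Y}$ is a family of probability distributions $W(\cdot\mid x)$ on $\mathcal{Y}$, $x\in\mathcal{X}$. Its symmetric capacity, with logarithm to base $q$, is $$I(W)=\sum_{x\in\mathcal{X}}\sum_{y\in\mathcal{Y}}\frac1q W(y\mid x)\log_q\frac{W(y\mid x)}{\frac1q\sum_{x'\in\mathcal{X}}W(y\mid x')}\in[0,1].$$ Channel transform: given a bijection $g:\mathcal{X}^\ell\to\mathcal{X}^\ell$ (the kernel), set $W^\ell(y_0^{\ell-1}\mid x_0^{\ell-1})=\prod_{i=0}^{\ell-1}W(y_i\mid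 x_i)$, and for $i\in\{0,\dots,\ell-1\}$ define the DMC $W^{(i)}:\mathcal{X}\to\mathcal{Y}^\ell\times\mathcal{X}^{i}$ by $$W^{(i)}(y_0^{\ell-1},u_0^{i-1}\mid u_i)=\frac1{q^{\ell-1}}\sum_{u_{i+1}^{\ell-1}\in\mathcal{X}^{\ell-1-i}}W^\ell(y_0^{\ell-1}\mid g(u_0^{\ell-1})).$$ Iterating, $W^{(b_1)\cdots(b_n)}=(W^{(b_1)\cdots(b_{n-1})})^{(b_n)}$. The sequence $B_1,B_2,\dots$ consists of independent random variables uniform on $\{0,\dots,\ell-1\}$. The sequence $I(W^{(B_1)\cdots(B_n)})$ converges almost surely to a random variable, denoted $I_\infty$. *)

theory Defs
  imports "HOL-Probability.Probability" "Jordan_Normal_Form.DL_Rank"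
begin

text \<open>
  Each channel transform changes the output alphabet, from \<open>Y\<close> to \<open>Y\<^sup>l \<times> X\<^sup>i\<close>. So that the transform can
  be iterated, the output alphabets of all the synthesised channels live in one type:
  \<open>Sym y\<close> is an output of the original channel, and \<open>Obs ys us\<close> is the pair of the outputs
  \<open>y\<^sub>0, \<dots>, y\<^sub>l\<^sub>-\<^sub>1\<close> and the previous inputs \<open>u\<^sub>0, \<dots>, u\<^sub>i\<^sub>-\<^sub>1\<close>.
  Transition probabilities are extended by zero to the elements of this type that do not belong
  to the output alphabet of the channel at hand; such elements contribute zero to the symmetric
  capacity.
\<close>

datatype ('x, 'y) out_symbol = Sym 'y | Obs "('x, 'y) out_symbol list" "'x list"

type_synonym ('x, 'y) channel = "'x \<Rightarrow> ('x, 'y) out_symbol \<Rightarrow> real"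

definition base_channel :: "('x \<Rightarrow> 'y pmf) \<Rightarrow> ('x, 'y) channel" where
  "base_channel W x z = (case z of Sym y \<Rightarrow> pmf (W x) y | Obs ys us \<Rightarrow> 0)"

text \<open>
  Summands with \<open>W x z = 0\<close> vanish, which is the usual convention \<open>0 log 0 = 0\<close>.
\<close>

definition symmetric_capacity :: "('x::finite \<Rightarrow> 'o \<Rightarrow> real) \<Rightarrow> real" where
  "symmetric_capacity W =
     (\<Sum>x\<in>UNIV. \<Sum>\<^sub>\<infinity>z\<in>UNIV. 1 / real CARD('x) * W x z *
        log (real CARD('x)) (W x z / (1 / real CARD('x) * (\<Sum>x'\<in>UNIV. W x' z))))"

text \<open>
  The channel \<open>W\<^sup>(\<^sup>i\<^sup>)\<close> obtained from the kernel \<open>g\<close> on \<open>X\<^sup>l\<close>, for \<open>i < l\<close>; elements of \<open>X\<^sup>l\<close> are lists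
  of length \<open>l\<close>, and \<open>vs\<close> ranges over \<open>u\<^sub>i\<^sub>+\<^sub>1, \<dots>, u\<^sub>l\<^sub>-\<^sub>1\<close>.
\<close>

definition channel_transform ::
  "nat \<Rightarrow> ('x::finite list \<Rightarrow> 'x list) \<Rightarrow> nat \<Rightarrow> ('x, 'y) channel \<Rightarrow> ('x, 'y) channel" where
  "channel_transform l g i W u z =
     (case z of
        Sym y \<Rightarrow> 0
      | Obs ys us \<Rightarrow>
          if length ys = l \<and> length us = i then
            1 / real CARD('x) ^ (l - 1) *
              (\<Sum>vs\<in>{vs. length vs = l - 1 - i}. \<Prod>j<l. W (g (us @ u # vs) ! j) (ys ! j))
          else 0)"

text \<open>
  For \<open>bs = [b\<^sub>1, \<dots>, b\<^sub>n]\<close> the transform with index \<open>b\<^sub>1\<close> is applied first.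
\<close>

definition iterated_channel ::
  "nat \<Rightarrow> ('x::finite list \<Rightarrow> 'x list) \<Rightarrow> ('x \<Rightarrow> 'y pmf) \<Rightarrow> nat list \<Rightarrow> ('x, 'y) channel" where
  "iterated_channel l g W bs = fold (channel_transform l g) bs (base_channel W)"

text \<open>
  The row vector \<open>u G\<close>, as \<open>(G\<^sup>T u\<^sup>T)\<^sup>T\<close>.
\<close>

definition linear_kernel :: "'x::comm_semiring_0 mat \<Rightarrow> 'x list \<Rightarrow> 'x list" where
  "linear_kernel G u = list_of_vec (transpose_mat G *\<^sub>v vec_of_list u)"

definition lower_triangular :: "'x::zero mat \<Rightarrow> bool" where
  "lower_triangular G \<longleftrightarrow> (\<forall>i<dim_row G. \<forall>j<dim_col G. i < j \<longrightarrow> G $$ (i, j) = 0)"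

definition primitive_element :: "'x::field \<Rightarrow> bool" where
  "primitive_element a \<longleftrightarrow> a \<noteq> 0 \<and> (\<forall>x. x \<noteq> 0 \<longrightarrow> (\<exists>n::nat. x = a ^ n))"

end

theory Submission
  imports Defs
begin

text \<open>
  Conditioned on an output, the input has a posterior distribution \<open>p\<close>; let \<open>A d\<close> be the average over
  the outputs of \<open>\<Sum>x. p x p (x + d)\<close>. Since the rows below \<open>k\<close> are diagonal, the channel \<open>W\<^sup>(\<^sup>k\<^sup>)\<close> can be
  degraded to one that shows its input \<open>u\<close> through \<open>W\<close> as \<open>G\<^sub>k\<^sub>k u\<close> and as \<open>c + G\<^sub>k\<^sub>j u\<close> with a known
  uniform \<open>c\<close>. The second look increases the capacity by at least a constant times
  \<open>A d (A 0 - A (a d))\<close> for every \<open>d\<close>, where \<open>a = G\<^sub>k\<^sub>j / G\<^sub>k\<^sub>k\<close>. If the increase is small, then either \<open>A d\<close>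
  is small for all \<open>d \<noteq> 0\<close>, which forces the capacity to be near 1, or, as \<open>a\<close> is primitive, \<open>A\<close> is
  almost constant, which forces the capacity to be near 0. Almost surely index \<open>k\<close> is used infinitely
  often, and along these steps the increase tends to 0 because the capacities converge.
\<close>

subsection \<open>Unnormalised entropy\<close>

text \<open>Strong convexity of \<open>t * ln t\<close> on (0, 1], where its second derivative
  \<open>1 / t\<close> is at least 1. The difference \<open>g\<close> of the two sides vanishes at
  \<open>m\<close>, and its derivative has the sign of \<open>t - m\<close> because
  \<open>ln\<close> has slope at least 1 there.\<close>

lemma kl_term_ge:
  fixes x m :: real
  assumes "0 \<le> x" "x \<le> 1" "0 < m" "m \<le> 1"
  shows "x - m + (x - m)\<^sup>2 / 2 \<le> x * ln (x / m)"
proof (cases "x = 0")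
  case True
  have "m * m \<le> m * 1" using assms by (intro mult_left_mono) auto
  with True assms show ?thesis by (simp add: power2_eq_square)
next
  case False
  with assms have x: "0 < x" by simp
  define g where "g t = t * (ln t - ln m) - (t - m) - (t - m)\<^sup>2 / 2" for t
  have deriv: "(g has_real_derivative ln t - ln m - (t - m)) (at t)" if "0 < t" for t
    unfolding g_def using that assms
    by (auto intro!: derivative_eq_intros simp: ln_div field_simps)
  have mono: "ln b - ln a \<ge> b - a" if "0 < a" "a \<le> b" "b \<le> 1" for a b :: real
  proof -
    have "ln (a / b) \<le> a / b - 1" using that by (intro ln_le_minus_one) simp
    moreover have "(b - a) * b \<le> (b - a) * 1" using that by (intro mult_left_mono) auto
    then have "b - a \<le> 1 - a / b" using that by (simp add: field_simps)
    ultimately show ?thesis using that by (simp add: ln_div)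
  qed
  have "g m \<le> g x"
  proof (cases "m \<le> x")
    case True
    then show ?thesis
    proof (rule DERIV_nonneg_imp_nondecreasing)
      fix t assume t: "m \<le> t" "t \<le> x"
      show "\<exists>y. (g has_real_derivative y) (at t) \<and> 0 \<le> y"
        using deriv[of t] mono[of m t] t assms by (intro exI conjI) auto
    qed
  next
    case False
    then have "x \<le> m" by simp
    then show ?thesis
    proof (rule DERIV_nonpos_imp_nonincreasing)
      fix t assume t: "x \<le> t" "t \<le> m"
      show "\<exists>y. (g has_real_derivative y) (at t) \<and> y \<le> 0"
        using deriv[of t] mono[of t m] t x assms by (intro exI conjI) auto
    qed
  qed
  then show ?thesis using assms x by (simp add: g_def ln_div)
qed

text \<open>
  For \<open>v x = W(z | x)\<close> and \<open>s = \<Sum> v\<close>, \<open>ent v\<close> is \<open>s\<close> times the entropy (in nats) of the posterior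
  \<open>v / s\<close>. Keeping it homogeneous avoids conditioning on outputs of probability zero; a summand
  with \<open>v x = 0\<close> vanishes.
\<close>

definition ent :: "('x::finite \<Rightarrow> real) \<Rightarrow> real" where
  "ent v = (\<Sum>x\<in>UNIV. v x * ln ((\<Sum>x'\<in>UNIV. v x') / v x))"

lemma le_sum_UNIV: "(\<And>x. 0 \<le> v x) \<Longrightarrow> v x \<le> (\<Sum>x\<in>UNIV. v x)" for v :: "'x::finite \<Rightarrow> real"
  by (rule member_le_sum) auto

lemma ent_term_nonneg:
  fixes v :: "'x::finite \<Rightarrow> real"
  assumes "\<And>x. 0 \<le> v x"
  shows "0 \<le> ln ((\<Sum>x\<in>UNIV. v x) / v x)"
proof (cases "v x = 0")
  case False
  then have "0 < v x" using assms[of x] by simp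
  then show ?thesis using le_sum_UNIV[of v x] assms by (intro ln_ge_zero) simp
qed simp

lemma ent_nonneg: "(\<And>x. 0 \<le> v x) \<Longrightarrow> 0 \<le> ent v"
  unfolding ent_def by (intro sum_nonneg mult_nonneg_nonneg ent_term_nonneg)

text \<open>Gibbs' inequality for unnormalised weights. Termwise, \<open>ln y <= y - 1\<close>
  leaves the remainder \<open>s * (w x / t) - v x\<close>, and the remainders sum to at most 0.
  Constant \<open>w\<close> bounds the entropy by that of the uniform law; a pushforward as
  \<open>w\<close> gives data processing.\<close>

lemma ent_gibbs:
  fixes v w :: "'x::finite \<Rightarrow> real"
  assumes v: "\<And>x. 0 \<le> v x" and w: "\<And>x. 0 \<le> w x" and ac: "\<And>x. 0 < v x \<Longrightarrow> 0 < w x"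
  shows "ent v \<le> (\<Sum>x\<in>UNIV. v x * ln ((\<Sum>x'\<in>UNIV. w x') / w x))"
proof -
  define s t where "s = (\<Sum>x\<in>UNIV. v x)" and "t = (\<Sum>x\<in>UNIV. w x)"
  have *: "v x * ln (s / v x) \<le> v x * ln (t / w x) + (s * (w x / t) - v x)" for x
  proof (cases "v x = 0")
    case True
    have "s \<ge> 0" "t \<ge> 0" unfolding s_def t_def by (auto intro!: sum_nonneg v w)
    then show ?thesis using True w[of x] by simp
  next
    case False
    then have vx: "0 < v x" using v[of x] by simp
    then have wx: "0 < w x" by (rule ac)
    have s: "0 < s" and t: "0 < t"
      using le_sum_UNIV[of v x] le_sum_UNIV[of w x] v w vx wx by (auto simp: s_def t_def)
    have "ln (s * w x / (t * v x)) \<le> s * w x / (t * v x) - 1"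
      using s t vx wx by (intro ln_le_minus_one) simp
    then have "v x * ln (s * w x / (t * v x)) \<le> v x * (s * w x / (t * v x) - 1)"
      using vx by (intro mult_left_mono) auto
    also have "\<dots> = s * (w x / t) - v x" using t vx by (simp add: field_simps)
    finally show ?thesis using s t vx wx by (simp add: ln_div ln_mult algebra_simps)
  qed
  have "(\<Sum>x\<in>UNIV. s * (w x / t) - v x) \<le> 0"
  proof (cases "t = 0")
    case False
    then show ?thesis
      by (simp add: sum_subtractf s_def[symmetric] t_def[symmetric]
          flip: sum_distrib_left sum_divide_distrib)
  qed (simp add: sum_nonneg v sum_negf)
  moreover have "(\<Sum>x\<in>UNIV. v x * ln (s / v x)) \<le>
      (\<Sum>x\<in>UNIV. v x * ln (t / w x) + (s * (w x / t) - v x))"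
    by (intro sum_mono *)
  ultimately show ?thesis
    unfolding ent_def s_def[symmetric] t_def[symmetric] by (simp add: sum.distrib)
qed

lemma ent_le:
  fixes v :: "'x::finite \<Rightarrow> real"
  assumes "\<And>x. 0 \<le> v x"
  shows "ent v \<le> (\<Sum>x\<in>UNIV. v x) * ln (real CARD('x))"
  using ent_gibbs[of v "\<lambda>_. 1"] assms by (simp add: sum_distrib_right)

lemma ent_scale: "0 \<le> c \<Longrightarrow> ent (\<lambda>x. c * v x) = c * ent v"
  by (cases "c = 0") (simp_all add: ent_def sum_distrib_left mult.assoc flip: sum_distrib_left)

text \<open>The entropy deficit against the uniform law is at most the chi-square distance to it:
  apply \<open>ln y <= y - 1\<close> to \<open>y = q * v x / s\<close>.\<close>

lemma ent_ge_collision: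
  fixes v :: "'x::finite \<Rightarrow> real"
  assumes v: "\<And>x. 0 \<le> v x" and s: "s = (\<Sum>x\<in>UNIV. v x)"
  shows "s * ln (real CARD('x)) - ent v \<le> real CARD('x) * ((\<Sum>x\<in>UNIV. v x * v x) / s) - s"
proof -
  have *: "v x * ln (real CARD('x)) - v x * ln (s / v x) \<le> real CARD('x) * (v x * v x / s) - v x" for x
  proof (cases "v x = 0")
    case False
    then have vx: "0 < v x" using v[of x] by simp
    then have s: "0 < s" using le_sum_UNIV[of v x] v by (simp add: s)
    have "ln (real CARD('x) * v x / s) \<le> real CARD('x) * v x / s - 1"
      using s vx by (intro ln_le_minus_one) simp
    then have "v x * ln (real CARD('x) * v x / s) \<le> v x * (real CARD('x) * v x / s - 1)"
      using vx by (intro mult_left_mono) auto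
    then show ?thesis using s vx by (simp add: ln_div ln_mult field_simps)
  qed simp
  have "(\<Sum>x\<in>UNIV. v x * ln (real CARD('x)) - v x * ln (s / v x)) \<le>
      (\<Sum>x\<in>UNIV. real CARD('x) * (v x * v x / s) - v x)"
    by (intro sum_mono *)
  then show ?thesis
    unfolding ent_def s[symmetric] sum_subtractf
    by (simp add: s sum_distrib_left sum_distrib_right sum_divide_distrib)
qed

text \<open>
  With \<open>t = sqrt p\<close>: \<open>- p ln p = 2 t\<^sup>2 ln (1 / t) \<le> 2 t (1 - t) \<le> L + (t (1 - t))\<^sup>2 / L\<close>.
\<close>

lemma neg_ln_le:
  fixes p L :: real
  assumes "0 < p" "p \<le> 1" "0 < L"
  shows "- (p * ln p) \<le> L + (p - p * p) / L"
proof -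
  define t where "t = sqrt p"
  have t: "0 < t" "t \<le> 1" "p = t * t" using assms by (auto simp: t_def)
  have "ln (1 / t) \<le> 1 / t - 1" using t by (intro ln_le_minus_one) simp
  then have "t * t * (2 * ln (1 / t)) \<le> t * t * (2 * (1 / t - 1))"
    using t by (intro mult_left_mono) auto
  also have "\<dots> = 2 * (t * (1 - t))" using t by (simp add: field_simps)
  finally have 1: "- (p * ln p) \<le> 2 * (t * (1 - t))"
    using t by (simp add: ln_mult ln_div algebra_simps)
  have "0 \<le> (L - t * (1 - t))\<^sup>2" by simp
  then have "2 * (t * (1 - t)) * L \<le> L * L + (t * (1 - t)) * (t * (1 - t))"
    by (simp add: power2_eq_square algebra_simps)
  \<comment> \<open>Weakening one factor \<open>1 - t\<close> to \<open>1 + t\<close> produces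
    \<open>t * t * (1 - t * t)\<close>, which is \<open>p - p * p\<close>.\<close>
  also have "(t * (1 - t)) * (t * (1 - t)) \<le> (t * (1 - t)) * (t * (1 + t))"
    using t by (intro mult_left_mono) auto
  also have "\<dots> = p - p * p" using t by (simp add: algebra_simps)
  finally have "2 * (t * (1 - t)) \<le> L + (p - p * p) / L"
    using assms by (simp add: field_simps)
  with 1 show ?thesis by linarith
qed

text \<open>This is \<open>neg_ln_le\<close> at \<open>p = v x / s\<close>, multiplied by
  \<open>s\<close> and summed. The free parameter \<open>L\<close> balances the two terms: a
  collision deficit of order \<open>L * L\<close> yields an entropy of order
  \<open>L\<close>.\<close>

lemma ent_le_collision:
  fixes v :: "'x::finite \<Rightarrow> real"
  assumes v: "\<And>x. 0 \<le> v x" and s: "s = (\<Sum>x\<in>UNIV. v x)" and L: "0 < L"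
  shows "ent v \<le> real CARD('x) * L * s + (s - (\<Sum>x\<in>UNIV. v x * v x) / s) / L"
proof -
  have *: "v x * ln (s / v x) \<le> L * s + (v x - v x * v x / s) / L" for x
  proof (cases "v x = 0")
    case True
    have "s \<ge> 0" unfolding s by (auto intro!: sum_nonneg v)
    then show ?thesis using True L by simp
  next
    case False
    then have vx: "0 < v x" using v[of x] by simp
    then have s0: "0 < s" "v x \<le> s" using le_sum_UNIV[of v x] v by (auto simp: s)
    have "- (v x / s * ln (v x / s)) \<le> L + (v x / s - v x / s * (v x / s)) / L"
      using s0 vx L by (intro neg_ln_le) auto
    then have "s * - (v x / s * ln (v x / s)) \<le> s * (L + (v x / s - v x / s * (v x / s)) / L)"
      using s0 by (intro mult_left_mono) auto
    also have "\<dots> = L * s + (v x - v x * v x / s) / L" using s0 L by (simp add: field_simps)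
    finally show ?thesis using s0 vx by (simp add: ln_div algebra_simps)
  qed
  have "(\<Sum>x\<in>UNIV. v x * ln (s / v x)) \<le> (\<Sum>x\<in>UNIV. L * s + (v x - v x * v x / s) / L)"
    by (intro sum_mono *)
  then show ?thesis
    unfolding ent_def s[symmetric] sum.distrib
    by (simp add: s sum_divide_distrib sum_subtractf flip: sum_divide_distrib)
qed

section \<open>Overlap of a posterior with its translates\<close>

lemma sum_affine:
  fixes f :: "'x::{field, finite} \<Rightarrow> 'b::comm_monoid_add"
  assumes "a \<noteq> 0"
  shows "(\<Sum>x\<in>UNIV. f (a * x + b)) = (\<Sum>x\<in>UNIV. f x)"
proof (rule sum.reindex_bij_witness[where i = "\<lambda>y. (y - b) / a" and j = "\<lambda>x. a * x + b"])
qed (use assms in auto)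

lemmas sum_shift = sum_affine[where a = 1, simplified]

text \<open>
  \<open>overlap v d / \<Sum> v\<close> is the probability that two independent samples from the posterior differ
  by \<open>d\<close>.
\<close>

definition overlap :: "('x::{field, finite} \<Rightarrow> real) \<Rightarrow> 'x \<Rightarrow> real" where
  "overlap v d = (\<Sum>x\<in>UNIV. v x * v (x + d)) / (\<Sum>x\<in>UNIV. v x)"

lemma overlap_nonneg: "(\<And>x. 0 \<le> v x) \<Longrightarrow> 0 \<le> overlap v d"
  unfolding overlap_def by (intro divide_nonneg_nonneg sum_nonneg mult_nonneg_nonneg)

lemma sum_overlap: "(\<Sum>d\<in>UNIV. overlap v d) = (\<Sum>x\<in>UNIV. v x)"
proof -
  have "(\<Sum>d\<in>UNIV. \<Sum>x\<in>UNIV. v x * v (x + d)) = (\<Sum>x\<in>UNIV. \<Sum>d\<in>UNIV. v x * v (d + x))"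
    by (subst sum.swap) (simp add: add.commute)
  also have "\<dots> = (\<Sum>x\<in>UNIV. v x) * (\<Sum>x\<in>UNIV. v x)"
    by (simp add: sum_shift flip: sum_distrib_left sum_distrib_right)
  finally show ?thesis by (simp add: overlap_def flip: sum_divide_distrib)
qed

text \<open>Expand the square; both pure square sums agree by translation invariance. This turns the
  variance bound of the entropy gain into overlaps.\<close>

lemma sum_square_diff_eq_overlap:
  "(\<Sum>x\<in>UNIV. (v x - v (x + d))\<^sup>2) / (\<Sum>x\<in>UNIV. v x) = 2 * (overlap v 0 - overlap v d)"
proof -
  have "(\<Sum>x\<in>UNIV. (v x - v (x + d))\<^sup>2) =
     (\<Sum>x\<in>UNIV. v x * v x) + (\<Sum>x\<in>UNIV. v (x + d) * v (x + d)) - 2 * (\<Sum>x\<in>UNIV. v x * v (x + d))"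
    by (simp add: power2_eq_square algebra_simps sum.distrib sum_subtractf sum_distrib_left)
  also have "(\<Sum>x\<in>UNIV. v (x + d) * v (x + d)) = (\<Sum>x\<in>UNIV. v x * v x)"
    by (rule sum_shift)
  finally show ?thesis
    by (simp add: overlap_def diff_divide_distrib add_divide_distrib)
qed

lemma overlap_le:
  assumes "\<And>x. 0 \<le> v x"
  shows "overlap v d \<le> overlap v 0"
proof -
  have "0 \<le> (\<Sum>x\<in>UNIV. (v x - v (x + d))\<^sup>2) / (\<Sum>x\<in>UNIV. v x)"
    by (intro divide_nonneg_nonneg sum_nonneg assms) auto
  then show ?thesis unfolding sum_square_diff_eq_overlap by simp
qed

lemma overlap_scale:
  assumes "a \<noteq> (0 :: 'x::{field, finite})"
  shows "overlap (\<lambda>x. v (a * x)) d = overlap v (a * d)"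
  unfolding overlap_def
  using sum_affine[OF assms, of "\<lambda>x. v x * v (x + a * d)" 0] sum_affine[OF assms, of v 0]
  by (simp add: distrib_left)

lemma ent_scale_arg:
  assumes "a \<noteq> (0 :: 'x::{field, finite})"
  shows "ent (\<lambda>x. v (a * x)) = ent v"
  unfolding ent_def
  using sum_affine[OF assms, of "\<lambda>x. v x * ln (sum v UNIV / v x)" 0] sum_affine[OF assms, of v 0]
  by simp

section \<open>Entropy gain from a second observation\<close>

text \<open>
  For fixed \<open>r\<close> and \<open>P\<close> the gain is a Jensen--Shannon divergence of the shifts \<open>P (c + h * u)\<close>, weighted by
  \<open>r\<close>; strong convexity of \<open>x ln x\<close> on \<open>[0, 1]\<close> bounds it below by their variance.
\<close>

lemma ent_gain_normalized:
  fixes r P :: "'x::{field, finite} \<Rightarrow> real"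
  assumes r: "\<And>x. 0 \<le> r x" "(\<Sum>x\<in>UNIV. r x) = 1"
    and P: "\<And>x. 0 \<le> P x" "(\<Sum>x\<in>UNIV. P x) = 1"
  shows "(\<Sum>c\<in>UNIV. ent (\<lambda>u. r u * P (c + h * u))) +
    (\<Sum>u\<in>UNIV. r u * r (u + d)) * (\<Sum>c\<in>UNIV. (P c - P (c + h * d))\<^sup>2) / 8 \<le> ent r"
proof -
  \<comment> \<open>The mixture of the shifted copies of \<open>P\<close> under the weights
    \<open>r\<close>.\<close>
  define m where "m c = (\<Sum>u\<in>UNIV. r u * P (c + h * u))" for c
  have P1: "P x \<le> 1" for x using le_sum_UNIV[of P x] P by simp
  have r1: "r x \<le> 1" for x using le_sum_UNIV[of r x] r by simp
  have m0: "0 \<le> m c" for c unfolding m_def by (intro sum_nonneg mult_nonneg_nonneg r P)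
  have m1: "m c \<le> 1" for c
    unfolding m_def r(2)[symmetric] by (intro sum_mono mult_left_le r P1)
  \<comment> \<open>Split the logarithm into \<open>ln (1 / r u)\<close> and
    \<open>ln (m c / P (c + h * u))\<close>, and bound the second part by
    \<open>kl_term_ge\<close>.\<close>
  have term_le: "r u * P (c + h * u) * ln (m c / (r u * P (c + h * u))) \<le>
      P (c + h * u) * (r u * ln (1 / r u)) - r u * (P (c + h * u) - m c)
        - r u * (P (c + h * u) - m c)\<^sup>2 / 2" for u c
  proof (cases "r u = 0 \<or> m c = 0")
    case True
    then show ?thesis
    proof
      assume "m c = 0"
      then have "r u * P (c + h * u) = 0"
        unfolding m_def using sum_nonneg_0[of UNIV "\<lambda>u. r u * P (c + h * u)" u] r P by auto
      with \<open>m c = 0\<close> show ?thesis by auto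
    qed simp
  next
    case False
    then have ru: "0 < r u" and mc: "0 < m c" using r(1)[of u] m0[of c] by auto
    have "r u * (P (c + h * u) - m c + (P (c + h * u) - m c)\<^sup>2 / 2) \<le>
        r u * (P (c + h * u) * ln (P (c + h * u) / m c))"
      using ru mc P P1 m1 by (intro mult_left_mono kl_term_ge) auto
    then show ?thesis using ru mc P(1)[of "c + h * u"]
      by (cases "P (c + h * u) = 0") (simp_all add: ln_div ln_mult field_simps)
  qed
  define V where "V = (\<Sum>c\<in>UNIV. \<Sum>u\<in>UNIV. r u * (P (c + h * u) - m c)\<^sup>2)"
  have "(\<Sum>c\<in>UNIV. ent (\<lambda>u. r u * P (c + h * u))) \<le>
     (\<Sum>c\<in>UNIV. \<Sum>u\<in>UNIV. P (c + h * u) * (r u * ln (1 / r u)) - r u * (P (c + h * u) - m c)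
        - r u * (P (c + h * u) - m c)\<^sup>2 / 2)"
    unfolding ent_def m_def[symmetric] by (intro sum_mono term_le)
  also have "\<dots> = (\<Sum>c\<in>UNIV. \<Sum>u\<in>UNIV. P (c + h * u) * (r u * ln (1 / r u)))
       - (\<Sum>c\<in>UNIV. \<Sum>u\<in>UNIV. r u * (P (c + h * u) - m c)) - V / 2"
    unfolding V_def sum_divide_distrib sum_subtractf ..
  also have "(\<Sum>c\<in>UNIV. \<Sum>u\<in>UNIV. P (c + h * u) * (r u * ln (1 / r u))) = ent r"
    unfolding ent_def r(2)
    by (subst sum.swap) (simp add: sum_shift P flip: sum_distrib_right)
  \<comment> \<open>The first-order terms cancel because \<open>m c\<close> is the
    \<open>r\<close>-average of \<open>P (c + h * u)\<close>.\<close>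
  also have "(\<Sum>c\<in>UNIV. \<Sum>u\<in>UNIV. r u * (P (c + h * u) - m c)) = 0"
    by (simp add: right_diff_distrib sum_subtractf r flip: sum_distrib_right m_def)
  finally have 1: "(\<Sum>c\<in>UNIV. ent (\<lambda>u. r u * P (c + h * u))) \<le> ent r - V / 2" by simp
  \<comment> \<open>Pairwise differences are controlled by deviations from the mean:
    \<open>(a - b)^2 <= 2 a^2 + 2 b^2\<close>, and one of the two weights is bounded by 1. Each of
    the two halves contributes 2; with the \<open>V / 2\<close> above, this gives the constant
    8.\<close>
  have 2: "(\<Sum>u\<in>UNIV. r u * r (u + d) * (P (c + h * u) - P (c + h * (u + d)))\<^sup>2) \<le>
      4 * (\<Sum>u\<in>UNIV. r u * (P (c + h * u) - m c)\<^sup>2)" for c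
  proof -
    have "(\<Sum>u\<in>UNIV. r u * r (u + d) * (P (c + h * u) - P (c + h * (u + d)))\<^sup>2) \<le>
       (\<Sum>u\<in>UNIV. 2 * (r u * (P (c + h * u) - m c)\<^sup>2) + 2 * (r (u + d) * (P (c + h * (u + d)) - m c)\<^sup>2))"
    proof (rule sum_mono)
      fix u
      let ?a = "P (c + h * u) - m c" and ?b = "P (c + h * (u + d)) - m c"
      have "(?a - ?b)\<^sup>2 \<le> 2 * ?a\<^sup>2 + 2 * ?b\<^sup>2"
        using zero_le_power2[of "?a + ?b"] by (simp add: power2_eq_square algebra_simps)
      then have "r u * r (u + d) * (?a - ?b)\<^sup>2 \<le> r u * r (u + d) * (2 * ?a\<^sup>2 + 2 * ?b\<^sup>2)"
        by (intro mult_left_mono mult_nonneg_nonneg r)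
      also have "\<dots> = r (u + d) * (2 * (r u * ?a\<^sup>2)) + r u * (2 * (r (u + d) * ?b\<^sup>2))"
        by (simp add: algebra_simps)
      also have "\<dots> \<le> 1 * (2 * (r u * ?a\<^sup>2)) + 1 * (2 * (r (u + d) * ?b\<^sup>2))"
        by (intro add_mono mult_right_mono r1 mult_nonneg_nonneg r) auto
      finally show "r u * r (u + d) * (P (c + h * u) - P (c + h * (u + d)))\<^sup>2
          \<le> 2 * (r u * ?a\<^sup>2) + 2 * (r (u + d) * ?b\<^sup>2)" by simp
    qed
    also have "\<dots> = 4 * (\<Sum>u\<in>UNIV. r u * (P (c + h * u) - m c)\<^sup>2)"
      using sum_shift[of "\<lambda>u. r u * (P (c + h * u) - m c)\<^sup>2" d]
      by (simp add: sum.distrib flip: sum_distrib_left)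
    finally show ?thesis .
  qed
  \<comment> \<open>The sum over \<open>c\<close> is translation invariant, so for each
    \<open>u\<close> it may be shifted by \<open>h * u\<close>.\<close>
  have "(\<Sum>u\<in>UNIV. r u * r (u + d)) * (\<Sum>c\<in>UNIV. (P c - P (c + h * d))\<^sup>2)
     = (\<Sum>u\<in>UNIV. r u * r (u + d) * (\<Sum>c\<in>UNIV. (P (c + h * u) - P (c + h * u + h * d))\<^sup>2))"
    using sum_shift[of "\<lambda>c. (P c - P (c + h * d))\<^sup>2"] by (simp add: sum_distrib_right)
  also have "\<dots> = (\<Sum>c\<in>UNIV. \<Sum>u\<in>UNIV. r u * r (u + d) * (P (c + h * u) - P (c + h * (u + d)))\<^sup>2)"
    by (subst sum.swap) (simp add: sum_distrib_left algebra_simps)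
  also have "\<dots> \<le> 4 * V"
    unfolding V_def by (subst sum_distrib_left, rule sum_mono, rule 2)
  finally show ?thesis using 1 by simp
qed

text \<open>Both sides are homogeneous of degree one in \<open>r\<close> and in \<open>P\<close>, so
  positive masses reduce to the normalised case; if a mass is zero, everything vanishes.\<close>

lemma ent_gain_raw:
  fixes r P :: "'x::{field, finite} \<Rightarrow> real"
  assumes r: "\<And>x. 0 \<le> r x" and s: "s = (\<Sum>x\<in>UNIV. r x)"
    and P: "\<And>x. 0 \<le> P x" and S: "S = (\<Sum>x\<in>UNIV. P x)"
  shows "(\<Sum>c\<in>UNIV. ent (\<lambda>u. r u * P (c + h * u))) +
    (\<Sum>u\<in>UNIV. r u * r (u + d)) / s * ((\<Sum>c\<in>UNIV. (P c - P (c + h * d))\<^sup>2) / S) / 8 \<le> S * ent r"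
proof (cases "s = 0 \<or> S = 0")
  case True
  then have "(\<forall>x. r x = 0) \<or> (\<forall>x. P x = 0)"
    using le_sum_UNIV[of r] le_sum_UNIV[of P] r P by (metis antisym s S)
  then show ?thesis by (auto simp: ent_def S)
next
  case False
  have "0 \<le> s" "0 \<le> S" unfolding s S by (auto intro!: sum_nonneg r P)
  with False have pos: "0 < s" "0 < S" by auto
  have "(\<Sum>c\<in>UNIV. ent (\<lambda>u. r u / s * (P (c + h * u) / S))) +
    (\<Sum>u\<in>UNIV. r u / s * (r (u + d) / s)) * (\<Sum>c\<in>UNIV. (P c / S - P (c + h * d) / S)\<^sup>2) / 8
      \<le> ent (\<lambda>u. r u / s)"
    using pos r P s S by (intro ent_gain_normalized) (auto simp flip: sum_divide_distrib)
  then have "s * S * ((\<Sum>c\<in>UNIV. ent (\<lambda>u. r u / s * (P (c + h * u) / S))) +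
    (\<Sum>u\<in>UNIV. r u / s * (r (u + d) / s)) * (\<Sum>c\<in>UNIV. (P c / S - P (c + h * d) / S)\<^sup>2) / 8)
      \<le> s * S * ent (\<lambda>u. r u / s)"
    using pos by (intro mult_left_mono) auto
  moreover have "s * S * (\<Sum>c\<in>UNIV. ent (\<lambda>u. r u / s * (P (c + h * u) / S))) =
      (\<Sum>c\<in>UNIV. ent (\<lambda>u. r u * P (c + h * u)))"
    using pos by (simp add: sum_distrib_left flip: ent_scale)
  moreover have "s * S * ent (\<lambda>u. r u / s) = S * ent r"
    using pos ent_scale[of s "\<lambda>u. r u / s"] by simp
  moreover have "s * S * ((\<Sum>u\<in>UNIV. r u / s * (r (u + d) / s)) * (\<Sum>c\<in>UNIV. (P c / S - P (c + h * d) / S)\<^sup>2) / 8)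
     = (\<Sum>u\<in>UNIV. r u * r (u + d)) / s * ((\<Sum>c\<in>UNIV. (P c - P (c + h * d))\<^sup>2) / S) / 8"
    using pos by (simp add: power_divide power2_eq_square flip: diff_divide_distrib sum_divide_distrib)
  ultimately show ?thesis by (simp add: distrib_left)
qed

lemma ent_gain:
  fixes r P :: "'x::{field, finite} \<Rightarrow> real"
  assumes "\<And>x. 0 \<le> r x" "\<And>x. 0 \<le> P x"
  shows "(\<Sum>c\<in>UNIV. ent (\<lambda>u. r u * P (c + h * u))) +
    overlap r d * (overlap P 0 - overlap P (h * d)) / 4 \<le> (\<Sum>x\<in>UNIV. P x) * ent r"
proof -
  \<comment> \<open>The factor 2 is the one in \<open>sum_square_diff_eq_overlap\<close>.\<close>
  have "a * (2 * b) / 8 = a * b / 4" for a b :: real by simp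
  with ent_gain_raw[of r "sum r UNIV" P "sum P UNIV" h d, OF assms(1) refl assms(2) refl]
  show ?thesis
    unfolding sum_square_diff_eq_overlap overlap_def[of r d, symmetric] by (simp only:)
qed

subsection \<open>Conditional entropy of a channel\<close>

abbreviation out_mass :: "('x::finite \<Rightarrow> 'o pmf) \<Rightarrow> 'o \<Rightarrow> real" where
  "out_mass K z \<equiv> (\<Sum>x\<in>UNIV. pmf (K x) z)"

lemma out_mass_nonneg: "0 \<le> out_mass K z"
  by (intro sum_nonneg) simp

lemma integrable_out_mass: "integrable (count_space UNIV) (out_mass K)"
  by (intro Bochner_Integration.integrable_sum integrable_pmf)

lemma integral_out_mass: "(\<integral>z. out_mass K z \<partial>count_space UNIV) = real CARD('x)"
  for K :: "'x::finite \<Rightarrow> 'o pmf"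
  by (simp add: Bochner_Integration.integral_sum integrable_pmf integral_pmf)

text \<open>The output mass has finite total \<open>q\<close> and serves as the common dominating
  function for entropies and overlaps.\<close>

lemma integrable_of_le_out_mass:
  assumes "\<And>z. \<bar>f z\<bar> \<le> c * out_mass K z"
  shows "integrable (count_space UNIV) f"
proof (rule Bochner_Integration.integrable_bound)
  show "integrable (count_space UNIV) (\<lambda>z. c * out_mass K z)"
    by (intro integrable_mult_right integrable_out_mass)
  have "\<bar>f z\<bar> \<le> \<bar>c * out_mass K z\<bar>" for z
    using assms[of z] by linarith
  then show "AE z in count_space UNIV. norm (f z) \<le> norm (c * out_mass K z)"
    by simp
qed simp

text \<open>\<open>cond_ent K\<close> is \<open>q\<close> times the conditional entropy of a uniform input given the output.\<close>

definition cond_ent :: "('x::finite \<Rightarrow> 'o pmf) \<Rightarrow> real" where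
  "cond_ent K = (\<integral>z. ent (\<lambda>x. pmf (K x) z) \<partial>count_space UNIV)"

lemma integrable_ent: "integrable (count_space UNIV) (\<lambda>z. ent (\<lambda>x. pmf (K x) z))"
  for K :: "'x::finite \<Rightarrow> 'o pmf"
  by (rule integrable_of_le_out_mass[where c = "ln (real CARD('x))" and K = K])
     (use ent_le[of "\<lambda>x. pmf (K x) _"] in \<open>auto simp: ent_nonneg mult.commute\<close>)

lemma cond_ent_nonneg: "0 \<le> cond_ent K"
  unfolding cond_ent_def by (intro integral_nonneg_AE) (simp add: ent_nonneg)

lemma cond_ent_le: "cond_ent K \<le> real CARD('x) * ln (real CARD('x))"
  for K :: "'x::finite \<Rightarrow> 'o pmf"
proof -
  have "cond_ent K \<le> (\<integral>z. out_mass K z * ln (real CARD('x)) \<partial>count_space UNIV)"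
    unfolding cond_ent_def
    by (intro integral_mono integrable_ent integrable_mult_left integrable_out_mass ent_le) simp
  then show ?thesis by (simp add: integral_out_mass)
qed

lemma nn_integral_ent:
  "(\<integral>\<^sup>+z. ennreal (ent (\<lambda>x. pmf (K x) z)) \<partial>count_space UNIV) = ennreal (cond_ent K)"
  unfolding cond_ent_def
  by (intro nn_integral_eq_integral integrable_ent) (simp add: ent_nonneg)

text \<open>Data processing. At each output \<open>z\<close>, apply Gibbs' inequality with the
  degraded channel at \<open>f z\<close> as reference. The logarithm then depends on
  \<open>z\<close> only through \<open>f z\<close>, so its integral against \<open>K x\<close> is
  one against the pushforward. Nonnegative integrals avoid integrability conditions on the
  logarithms.\<close>

lemma cond_ent_map_le:
  fixes K :: "'x::finite \<Rightarrow> 'o pmf"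
  shows "cond_ent K \<le> cond_ent (\<lambda>x. map_pmf f (K x))"
proof -
  let ?K = "\<lambda>x. map_pmf f (K x)"
  let ?l = "\<lambda>x w. ennreal (ln (out_mass ?K w / pmf (?K x) w))"
  have l: "0 \<le> ln (out_mass ?K w / pmf (?K x) w)" for x w
    by (rule ent_term_nonneg) simp
  have "ent (\<lambda>x. pmf (K x) z) \<le>
      (\<Sum>x\<in>UNIV. pmf (K x) z * ln (out_mass ?K (f z) / pmf (?K x) (f z)))" for z
    by (rule ent_gibbs) (auto simp: pmf_positive_iff)
  then have "ennreal (ent (\<lambda>x. pmf (K x) z)) \<le> (\<Sum>x\<in>UNIV. ennreal (pmf (K x) z) * ?l x (f z))" for z
    by (simp add: l sum_nonneg flip: ennreal_mult)
  then have "ennreal (cond_ent K) \<le>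
      (\<integral>\<^sup>+z. (\<Sum>x\<in>UNIV. ennreal (pmf (K x) z) * ?l x (f z)) \<partial>count_space UNIV)"
    unfolding nn_integral_ent[symmetric] by (intro nn_integral_mono) simp
  also have "\<dots> = (\<Sum>x\<in>UNIV. \<integral>\<^sup>+z. ?l x (f z) \<partial>measure_pmf (K x))"
    by (simp add: nn_integral_sum nn_integral_measure_pmf)
  also have "\<dots> = (\<Sum>x\<in>UNIV. \<integral>\<^sup>+w. ?l x w \<partial>measure_pmf (?K x))"
    by simp
  also have "\<dots> = (\<integral>\<^sup>+w. (\<Sum>x\<in>UNIV. ennreal (pmf (?K x) w) * ?l x w) \<partial>count_space UNIV)"
    by (subst nn_integral_sum) (simp_all only: nn_integral_measure_pmf borel_measurable_count_space)
  also have "\<dots> = (\<integral>\<^sup>+w. ennreal (ent (\<lambda>x. pmf (?K x) w)) \<partial>count_space UNIV)"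
    by (intro nn_integral_cong) (simp add: ent_def l sum_nonneg flip: ennreal_mult)
  also have "\<dots> = ennreal (cond_ent ?K)" by (rule nn_integral_ent)
  finally show ?thesis by (simp add: cond_ent_nonneg)
qed

text \<open>This is \<open>q\<close> times the average A d of the overview, as outputs are weighted
  by \<open>out_mass\<close> and not by \<open>out_mass / q\<close>.\<close>

definition collision :: "('x::{field, finite} \<Rightarrow> 'o pmf) \<Rightarrow> 'x \<Rightarrow> real" where
  "collision K d = (\<integral>z. overlap (\<lambda>x. pmf (K x) z) d \<partial>count_space UNIV)"

lemma integrable_overlap:
  fixes K :: "'x::{field, finite} \<Rightarrow> 'o pmf"
  shows "integrable (count_space UNIV) (\<lambda>z. overlap (\<lambda>x. pmf (K x) z) d)"
proof (rule integrable_of_le_out_mass[where c = 1 and K = K])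
  fix z
  have "overlap (\<lambda>x. pmf (K x) z) d \<le> (\<Sum>d\<in>UNIV. overlap (\<lambda>x. pmf (K x) z) d)"
    by (rule le_sum_UNIV) (simp add: overlap_nonneg)
  then show "\<bar>overlap (\<lambda>x. pmf (K x) z) d\<bar> \<le> 1 * out_mass K z"
    by (simp add: sum_overlap overlap_nonneg)
qed

lemma collision_nonneg: "0 \<le> collision K d"
  unfolding collision_def by (intro integral_nonneg_AE) (simp add: overlap_nonneg)

lemma sum_collision: "(\<Sum>d\<in>UNIV. collision K d) = real CARD('x)"
  for K :: "'x::{field, finite} \<Rightarrow> 'o pmf"
  unfolding collision_def
  by (subst Bochner_Integration.integral_sum[symmetric])
     (simp_all only: integrable_overlap sum_overlap integral_out_mass)

lemma collision_le: "collision K d \<le> collision K 0"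
  unfolding collision_def by (intro integral_mono integrable_overlap overlap_le) simp

text \<open>It is the largest of \<open>q\<close> numbers whose sum is \<open>q\<close>.\<close>

lemma collision_0_ge: "1 \<le> collision (K :: 'x::{field, finite} \<Rightarrow> 'o pmf) 0"
proof -
  have "real CARD('x) \<le> (\<Sum>d\<in>(UNIV :: 'x set). collision K 0)"
    unfolding sum_collision[of K, symmetric] by (intro sum_mono collision_le)
  then show ?thesis by simp
qed

text \<open>Integrated form of \<open>ent_le_collision\<close>: a collision value near its maximum
  \<open>q\<close> means nearly deterministic posteriors.\<close>

lemma cond_ent_le_collision:
  fixes K :: "'x::{field, finite} \<Rightarrow> 'o pmf"
  assumes L: "0 < L"
  shows "cond_ent K \<le> (real CARD('x))\<^sup>2 * L + (real CARD('x) - collision K 0) / L"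
proof -
  let ?t = "\<lambda>z. overlap (\<lambda>x. pmf (K x) z) 0"
  have *: "integrable (count_space UNIV) (\<lambda>z. (out_mass K z - ?t z) / L)"
    by (intro integrable_divide Bochner_Integration.integrable_diff integrable_overlap integrable_out_mass)
  have "cond_ent K \<le> (\<integral>z. real CARD('x) * L * out_mass K z + (out_mass K z - ?t z) / L \<partial>count_space UNIV)"
    unfolding cond_ent_def
    by (intro integral_mono Bochner_Integration.integrable_add * integrable_mult_right
        integrable_out_mass integrable_ent)
       (use ent_le_collision[OF _ refl L, of "\<lambda>x. pmf (K x) _"] in \<open>simp add: overlap_def\<close>)
  also have "\<dots> = real CARD('x) * L * (\<integral>z. out_mass K z \<partial>count_space UNIV)
      + ((\<integral>z. out_mass K z \<partial>count_space UNIV) - (\<integral>z. ?t z \<partial>count_space UNIV)) / L"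
    by (subst Bochner_Integration.integral_add)
       (simp_all only: * integrable_mult_right integrable_out_mass integral_mult_right_zero
         integral_divide_zero integrable_overlap Bochner_Integration.integral_diff)
  finally show ?thesis
    by (simp add: integral_out_mass power2_eq_square mult_ac flip: collision_def)
qed

text \<open>Integrated form of \<open>ent_ge_collision\<close>: a collision value near its minimum 1
  means nearly uniform posteriors.\<close>

lemma cond_ent_ge_collision:
  fixes K :: "'x::{field, finite} \<Rightarrow> 'o pmf"
  shows "real CARD('x) * ln (real CARD('x)) - cond_ent K \<le> real CARD('x) * collision K 0 - real CARD('x)"
proof -
  let ?t = "\<lambda>z. overlap (\<lambda>x. pmf (K x) z) 0"
  have "(\<integral>z. out_mass K z * ln (real CARD('x)) - ent (\<lambda>x. pmf (K x) z) \<partial>count_space UNIV) \<le>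
     (\<integral>z. real CARD('x) * ?t z - out_mass K z \<partial>count_space UNIV)"
    by (intro integral_mono Bochner_Integration.integrable_diff integrable_overlap
        integrable_mult_right integrable_mult_left integrable_out_mass integrable_ent)
       (use ent_ge_collision[OF _ refl, of "\<lambda>x. pmf (K x) _"] in \<open>simp add: overlap_def\<close>)
  moreover have "(\<integral>z. out_mass K z * ln (real CARD('x)) - ent (\<lambda>x. pmf (K x) z) \<partial>count_space UNIV)
      = real CARD('x) * ln (real CARD('x)) - cond_ent K"
    unfolding cond_ent_def integral_out_mass[of K, symmetric]
    by (simp only: integrable_mult_left integrable_out_mass integral_mult_left_zero
         integrable_ent Bochner_Integration.integral_diff)
  moreover have "(\<integral>z. real CARD('x) * ?t z - out_mass K z \<partial>count_space UNIV) =
      real CARD('x) * collision K 0 - real CARD('x)"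
    unfolding collision_def
    by (simp only: integrable_mult_right integrable_out_mass integral_mult_right_zero
         integrable_overlap Bochner_Integration.integral_diff integral_out_mass)
  ultimately show ?thesis by simp
qed

section \<open>Two observations of one input\<close>

text \<open>
  The input \<open>u\<close> is seen through \<open>K\<close> once as \<open>g u\<close> and once as \<open>c + h u\<close>, where the uniform pad \<open>c\<close> is
  revealed.
\<close>

definition two_looks :: "'x::{field, finite} \<Rightarrow> 'x \<Rightarrow> ('x \<Rightarrow> 'o pmf) \<Rightarrow> 'x \<Rightarrow> ('o \<times> 'o \<times> 'x) pmf" where
  "two_looks g h K u =
     pmf_of_set UNIV \<bind> (\<lambda>c. map_pmf (\<lambda>(y, y'). (y, y', c)) (pair_pmf (K (g * u)) (K (c + h * u))))"

lemma pmf_two_looks: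
  fixes K :: "'x::{field, finite} \<Rightarrow> 'o pmf"
  shows "pmf (two_looks g h K u) (y, y', c) = 1 / real CARD('x) * (pmf (K (g * u)) y * pmf (K (c + h * u)) y')"
proof -
  have "pmf (map_pmf (\<lambda>(y, y'). (y, y', b)) (pair_pmf (K (g * u)) (K (b + h * u)))) (y, y', c) =
      (if b = c then pmf (K (g * u)) y * pmf (K (c + h * u)) y' else 0)" for b
  proof (cases "b = c")
    case True
    have "inj (\<lambda>(y, y'). (y, y', c))" by (auto simp: inj_def)
    from pmf_map_inj'[OF this, of _ "(y, y')"] show ?thesis
      using True by (simp add: pmf_pair)
  next
    case False
    then show ?thesis by (auto intro!: pmf_map_outside)
  qed
  then show ?thesis by (simp add: two_looks_def pmf_bind_pmf_of_set)
qed

text \<open>For each pair of outputs, \<open>ent_gain\<close> applies with the first look as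
  \<open>r\<close> and the second as \<open>P\<close>. Its gain is a product of a function of
  \<open>y\<close> and a function of \<open>y'\<close>, so integrating over both outputs gives a
  product of collision terms.\<close>

lemma cond_ent_two_looks:
  fixes K :: "'x::{field, finite} \<Rightarrow> 'o pmf"
  assumes g: "g \<noteq> 0"
  shows "cond_ent (two_looks g h K) +
    collision K (g * d) * (collision K 0 - collision K (h * d)) / (4 * real CARD('x)) \<le> cond_ent K"
proof -
  let ?q = "real CARD('x)"
  let ?r = "\<lambda>y u. pmf (K (g * u)) y" and ?P = "\<lambda>y' x. pmf (K x) y'"
  let ?F = "\<lambda>y y'. \<Sum>c\<in>UNIV. ent (\<lambda>u. ?r y u * ?P y' (c + h * u))"
  let ?D = "\<lambda>y'. overlap (?P y') 0 - overlap (?P y') (h * d)"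
  let ?c = "count_space (UNIV :: 'o set)"
  have D: "0 \<le> ?D y'" for y' by (simp add: overlap_le)
  have F: "0 \<le> ?F y y'" for y y' by (intro sum_nonneg ent_nonneg) simp
  have pointwise: "?F y y' + overlap (?P y) (g * d) * ?D y' / 4 \<le> out_mass K y' * ent (?P y)" for y y'
  proof -
    have "?F y y' + overlap (?r y) d * ?D y' / 4 \<le> out_mass K y' * ent (?r y)"
      by (rule ent_gain) auto
    moreover have "ent (?r y) = ent (?P y)" by (rule ent_scale_arg[OF g])
    moreover have "overlap (?r y) d = overlap (?P y) (g * d)" by (rule overlap_scale[OF g])
    ultimately show ?thesis by simp
  qed
  have "ennreal (cond_ent (two_looks g h K)) =
      (\<integral>\<^sup>+z. ennreal (ent (\<lambda>u. pmf (two_looks g h K u) z)) \<partial>count_space UNIV)"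
    by (rule nn_integral_ent[symmetric])
  also have "\<dots> = (\<integral>\<^sup>+y. \<integral>\<^sup>+y'. \<integral>\<^sup>+c. ennreal (ent (\<lambda>u. pmf (two_looks g h K u) (y, y', c)))
      \<partial>count_space UNIV \<partial>?c \<partial>?c)"
    by (simp only: nn_integral_fst_count_space[symmetric])
  also have "\<dots> = (\<integral>\<^sup>+y. \<integral>\<^sup>+y'. ennreal (?F y y' / ?q) \<partial>?c \<partial>?c)"
    by (intro nn_integral_cong)
       (simp add: pmf_two_looks ent_scale[of "1 / ?q", simplified] nn_integral_count_space_finite
         ent_nonneg sum_divide_distrib)
  finally have 1: "ennreal (cond_ent (two_looks g h K)) = (\<integral>\<^sup>+y. \<integral>\<^sup>+y'. ennreal (?F y y' / ?q) \<partial>?c \<partial>?c)" .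
  have intD: "integrable ?c ?D" "(\<integral>y'. ?D y' \<partial>?c) = collision K 0 - collision K (h * d)"
    by (simp_all only: collision_def Bochner_Integration.integrable_diff
        Bochner_Integration.integral_diff integrable_overlap)
  have 2: "ennreal (collision K (g * d) * (collision K 0 - collision K (h * d)) / (4 * ?q)) =
      (\<integral>\<^sup>+y. \<integral>\<^sup>+y'. ennreal (overlap (?P y) (g * d) * ?D y' / (4 * ?q)) \<partial>?c \<partial>?c)"
  proof -
    have "(\<integral>\<^sup>+y'. ennreal (overlap (?P y) (g * d) * ?D y' / (4 * ?q)) \<partial>?c) =
        ennreal (overlap (?P y) (g * d) * (collision K 0 - collision K (h * d)) / (4 * ?q))" for y
    proof -
      have "(\<integral>\<^sup>+y'. ennreal (overlap (?P y) (g * d) * ?D y' / (4 * ?q)) \<partial>?c) =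
          ennreal (\<integral>y'. overlap (?P y) (g * d) * ?D y' / (4 * ?q) \<partial>?c)"
      proof (rule nn_integral_eq_integral)
        show "integrable ?c (\<lambda>y'. overlap (?P y) (g * d) * ?D y' / (4 * ?q))"
          by (intro integrable_divide integrable_mult_right intD)
        show "AE y' in ?c. 0 \<le> overlap (?P y) (g * d) * ?D y' / (4 * ?q)"
          by (intro AE_I2 divide_nonneg_nonneg mult_nonneg_nonneg D overlap_nonneg) auto
      qed
      then show ?thesis
        by (simp only: integral_divide_zero integral_mult_right_zero intD)
    qed
    then show ?thesis
      using nn_integral_eq_integral[of ?c "\<lambda>y. overlap (?P y) (g * d) * (collision K 0 - collision K (h * d)) / (4 * ?q)"]
      by (simp add: integrable_overlap overlap_nonneg collision_le flip: collision_def)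
  qed
  \<comment> \<open>The integral of \<open>out_mass\<close> over \<open>y'\<close> is
    \<open>q\<close>, which cancels the probability \<open>1 / q\<close> of the pad.\<close>
  have 3: "ennreal (cond_ent K) = (\<integral>\<^sup>+y. \<integral>\<^sup>+y'. ennreal (out_mass K y' * ent (?P y) / ?q) \<partial>?c \<partial>?c)"
  proof -
    have "(\<integral>\<^sup>+y'. ennreal (out_mass K y' * ent (?P y) / ?q) \<partial>?c) = ennreal (ent (?P y))" for y
      using nn_integral_eq_integral[of ?c "\<lambda>y'. out_mass K y' * ent (?P y) / ?q"]
      by (simp add: integrable_out_mass integral_out_mass ent_nonneg out_mass_nonneg)
    then show ?thesis by (simp add: nn_integral_ent)
  qed
  have "ennreal (cond_ent (two_looks g h K) +
      collision K (g * d) * (collision K 0 - collision K (h * d)) / (4 * ?q)) =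
     (\<integral>\<^sup>+y. \<integral>\<^sup>+y'. ennreal (?F y y' / ?q + overlap (?P y) (g * d) * ?D y' / (4 * ?q)) \<partial>?c \<partial>?c)"
    using F D 1 2
    by (simp add: nn_integral_add cond_ent_nonneg collision_nonneg collision_le overlap_nonneg)
  also have "\<dots> \<le> ennreal (cond_ent K)"
    unfolding 3
  proof (intro nn_integral_mono ennreal_leI)
    fix y y'
    show "?F y y' / ?q + overlap (?P y) (g * d) * ?D y' / (4 * ?q) \<le> out_mass K y' * ent (?P y) / ?q"
      using divide_right_mono[OF pointwise[of y y'], of ?q] by (simp add: add_divide_distrib)
  qed
  finally show ?thesis by (simp add: cond_ent_nonneg)
qed

section \<open>Symmetric capacity through conditional entropy\<close>

lemma two_le_card_field: "2 \<le> CARD('x::{field, finite})"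
proof -
  have "card {0, 1 :: 'x} \<le> CARD('x)" by (rule card_mono) auto
  then show ?thesis by simp
qed

text \<open>Where \<open>p = pmf (K x) z\<close> is positive and \<open>s\<close> is the output
  mass, the base-\<open>q\<close> logarithm of \<open>p / (s / q)\<close> is
  \<open>1 - ln (s / p) / ln q\<close>. The remaining work is to identify the infinite sum with an
  integral, by absolute summability.\<close>

lemma symmetric_capacity_pmf:
  fixes K :: "'x::{field, finite} \<Rightarrow> 'o pmf"
  shows "symmetric_capacity (\<lambda>x. pmf (K x)) = 1 - cond_ent K / (real CARD('x) * ln (real CARD('x)))"
proof -
  let ?q = "real CARD('x)"
  have q: "1 < ?q" using two_le_card_field[where 'x = 'x] by linarith
  then have lnq: "0 < ln ?q" by simp
  let ?t = "\<lambda>x z. pmf (K x) z * ln (out_mass K z / pmf (K x) z)"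
  have summand: "1 / ?q * pmf (K x) z * log ?q (pmf (K x) z / (1 / ?q * out_mass K z)) =
      (pmf (K x) z - ?t x z / ln ?q) / ?q" for x z
  proof (cases "pmf (K x) z = 0")
    case False
    then have p: "0 < pmf (K x) z" by (simp add: pmf_positive_iff set_pmf_iff)
    then have "0 < out_mass K z" using le_sum_UNIV[of "\<lambda>x. pmf (K x) z" x] by simp
    then show ?thesis using p q lnq by (simp add: log_def ln_div ln_mult field_simps)
  qed simp
  have int: "integrable (count_space UNIV) (?t x)" for x
  proof (rule integrable_of_le_out_mass[where c = "ln ?q" and K = K])
    fix z
    have t: "0 \<le> ?t x z" for x by (intro mult_nonneg_nonneg ent_term_nonneg) auto
    have "?t x z \<le> ent (\<lambda>x. pmf (K x) z)"
      unfolding ent_def by (rule le_sum_UNIV[of "\<lambda>x. ?t x z"]) (rule t)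
    also have "\<dots> \<le> out_mass K z * ln ?q" by (rule ent_le) simp
    finally show "\<bar>?t x z\<bar> \<le> ln ?q * out_mass K z" using t[of x] by (simp add: mult.commute)
  qed
  have infsum_eq: "(\<Sum>\<^sub>\<infinity>z\<in>UNIV. (pmf (K x) z - ?t x z / ln ?q) / ?q) =
      (1 - (\<integral>z. ?t x z \<partial>count_space UNIV) / ln ?q) / ?q" for x
  proof -
    have *: "integrable (count_space UNIV) (\<lambda>z. (pmf (K x) z - ?t x z / ln ?q) / ?q)"
      by (intro integrable_divide Bochner_Integration.integrable_diff integrable_pmf int)
    then have "(\<Sum>\<^sub>\<infinity>z\<in>UNIV. (pmf (K x) z - ?t x z / ln ?q) / ?q) =
        (\<integral>z. (pmf (K x) z - ?t x z / ln ?q) / ?q \<partial>count_space UNIV)"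
      by (subst infsetsum_infsum[symmetric]) (simp_all add: abs_summable_on_def infsetsum_def)
    also have "\<dots> = ((\<integral>z. pmf (K x) z \<partial>count_space UNIV) - (\<integral>z. ?t x z \<partial>count_space UNIV) / ln ?q) / ?q"
      by (simp only: integral_divide_zero Bochner_Integration.integral_diff integrable_divide
          integrable_pmf int)
    finally show ?thesis by (simp add: integral_pmf)
  qed
  have "symmetric_capacity (\<lambda>x. pmf (K x)) =
      (\<Sum>x\<in>UNIV. (1 - (\<integral>z. ?t x z \<partial>count_space UNIV) / ln ?q) / ?q)"
    unfolding symmetric_capacity_def summand infsum_eq ..
  also have "\<dots> = 1 - (\<Sum>x\<in>UNIV. \<integral>z. ?t x z \<partial>count_space UNIV) / (?q * ln ?q)"
    using q by (simp add: sum_subtractf diff_divide_distrib mult.commute flip: sum_divide_distrib)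
  also have "(\<Sum>x\<in>UNIV. \<integral>z. ?t x z \<partial>count_space UNIV) = cond_ent K"
    unfolding cond_ent_def ent_def by (rule Bochner_Integration.integral_sum[symmetric]) (rule int)
  finally show ?thesis .
qed

lemma symmetric_capacity_bounds:
  fixes K :: "'x::{field, finite} \<Rightarrow> 'o pmf"
  shows "0 \<le> symmetric_capacity (\<lambda>x. pmf (K x))" "symmetric_capacity (\<lambda>x. pmf (K x)) \<le> 1"
proof -
  let ?q = "real CARD('x)"
  have q: "1 < ?q" using two_le_card_field[where 'x = 'x] by linarith
  then have "0 < ?q * ln ?q" by simp
  then show "0 \<le> symmetric_capacity (\<lambda>x. pmf (K x))" "symmetric_capacity (\<lambda>x. pmf (K x)) \<le> 1"
    using cond_ent_le[of K] cond_ent_nonneg[of K] by (simp_all add: symmetric_capacity_pmf)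
qed

subsection \<open>Dichotomy\<close>

text \<open>
  If \<open>A d\<close> is not small for one \<open>d \<noteq> 0\<close>, then \<open>A (a * d)\<close> is almost as large as \<open>A 0\<close>, and this
  propagates along the powers of the primitive element \<open>a\<close> to all of the field.
\<close>

lemma overlap_chain:
  fixes A :: "'x::{field, finite} \<Rightarrow> real"
  assumes ge1: "1 \<le> A 0"
    and total: "(\<Sum>d\<in>UNIV. A d) = real CARD('x)"
    and prim: "primitive_element a"
    and th: "0 < th" "th \<le> 1 / 2"
    and step: "\<And>d. d \<noteq> 0 \<Longrightarrow> A d * (A 0 - A (a * d)) \<le> th\<^sup>2"
    and d: "d \<noteq> 0" "th < A d"
  shows "A 0 \<le> 1 + th"
proof -
  have a: "a \<noteq> 0" using prim by (simp add: primitive_element_def)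
  \<comment> \<open>Dividing the bound \<open>th * th\<close> by a value \<open>A e\<close> of at
    least \<open>th\<close> leaves \<open>th\<close>.\<close>
  have drop: "A 0 - A (a * e) \<le> th" if "e \<noteq> 0" "th \<le> A e" for e
  proof (cases "0 \<le> A 0 - A (a * e)")
    case True
    have "th * (A 0 - A (a * e)) \<le> A e * (A 0 - A (a * e))"
      using that True by (intro mult_right_mono) auto
    also have "\<dots> \<le> th * th" using step[OF that(1)] by (simp add: power2_eq_square)
    finally show ?thesis using th by simp
  qed (use th in simp)
  \<comment> \<open>The induction reproduces its own hypothesis since
    \<open>A 0 - th >= 1 - th >= th\<close>; this is where \<open>th <= 1 / 2\<close>
    enters.\<close>
  have pow: "th \<le> A (a ^ n * d)" for n
  proof (induction n)
    case (Suc n)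
    then have "A 0 - A (a * (a ^ n * d)) \<le> th" using a d by (intro drop) auto
    then show ?case using ge1 th by (simp add: mult.assoc)
  qed (use d in simp)
  have close: "A 0 - th \<le> A e" for e
  proof (cases "e = 0")
    case False
    \<comment> \<open>Dividing by \<open>a * d\<close> rather than \<open>d\<close> reserves one
      last application of \<open>drop\<close> that ends exactly at \<open>e\<close>, so the loss is
      \<open>th\<close> regardless of the exponent.\<close>
    then have "e / (a * d) \<noteq> 0" using a d by simp
    with prim obtain n where n: "e / (a * d) = a ^ n" unfolding primitive_element_def by blast
    have "A 0 - A (a * (a ^ n * d)) \<le> th" using a d by (intro drop pow) auto
    moreover have "a * (a ^ n * d) = e" using a d by (simp add: n[symmetric])
    ultimately show ?thesis by simp
  qed (use th in simp)
  \<comment> \<open>The lower bound \<open>A 0 - th\<close> cannot exceed the mean of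
    \<open>A\<close>, which is 1.\<close>
  have "real CARD('x) * (A 0 - th) = (\<Sum>e\<in>(UNIV :: 'x set). A 0 - th)" by simp
  also have "\<dots> \<le> real CARD('x) * 1"
    unfolding mult_1_right total[symmetric] by (intro sum_mono close)
  finally show ?thesis by (simp add: mult_le_cancel_left)
qed

text \<open>If some nonzero shift has collision above \<open>L^2\<close>, then
  \<open>overlap_chain\<close> puts the collision at 0 near 1 and the capacity below
  \<open>e\<close>. Otherwise the collision at 0 is within \<open>q^2 * L^2\<close> of
  \<open>q\<close> and the capacity exceeds \<open>1 - e\<close>.\<close>

lemma capacity_dichotomy:
  fixes a :: "'x::{field, finite}"
  assumes prim: "primitive_element a" and eps: "0 < e"
  shows "\<exists>\<delta>>0. \<forall>K :: 'x \<Rightarrow> 'o pmf.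
    (\<forall>d. d \<noteq> 0 \<longrightarrow> collision K d * (collision K 0 - collision K (a * d)) \<le> \<delta>) \<longrightarrow>
    symmetric_capacity (\<lambda>x. pmf (K x)) < e \<or> 1 - e < symmetric_capacity (\<lambda>x. pmf (K x))"
proof -
  let ?q = "real CARD('x)"
  have q: "1 < ?q" using two_le_card_field[where 'x = 'x] by linarith
  then have lnq: "0 < ln ?q" by simp
  \<comment> \<open>The second bound ensures \<open>2 * q * L < e * ln q\<close>, which both cases
    use; the first makes \<open>L^2\<close> an admissible threshold in
    \<open>overlap_chain\<close>.\<close>
  define L where "L = min (1 / 2) (e * ln ?q / (4 * ?q))"
  have L: "0 < L" "L \<le> 1 / 2" using q lnq eps by (auto simp: L_def)
  have "L \<le> e * ln ?q / (4 * ?q)" by (simp add: L_def)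
  then have "L * (4 * ?q) \<le> e * ln ?q"
    using q by (simp add: pos_le_divide_eq)
  moreover have "0 < ?q * L" using q L by simp
  ultimately have Lq: "2 * ?q * L < e * ln ?q" by (simp add: algebra_simps)
  have th: "0 < L\<^sup>2" "L\<^sup>2 \<le> L" using L by (auto simp: power2_eq_square)
  show ?thesis
  \<comment> \<open>The threshold is \<open>L^2\<close>, not \<open>L\<close>, because
    \<open>cond_ent_le_collision\<close> divides the deficit by \<open>L\<close>;
    \<open>overlap_chain\<close> squares it once more.\<close>
  proof (intro exI[of _ "(L\<^sup>2)\<^sup>2"] conjI allI impI)
    fix K :: "'x \<Rightarrow> 'o pmf"
    assume step: "\<forall>d. d \<noteq> 0 \<longrightarrow> collision K d * (collision K 0 - collision K (a * d)) \<le> (L\<^sup>2)\<^sup>2"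
    show "symmetric_capacity (\<lambda>x. pmf (K x)) < e \<or> 1 - e < symmetric_capacity (\<lambda>x. pmf (K x))"
    proof (cases "\<exists>d. d \<noteq> 0 \<and> L\<^sup>2 < collision K d")
      case True
      then obtain d where "d \<noteq> 0" "L\<^sup>2 < collision K d" by blast
      then have "collision K 0 \<le> 1 + L\<^sup>2"
        using step th L by (intro overlap_chain[OF collision_0_ge sum_collision prim]) auto
      then have "?q * collision K 0 \<le> ?q * (1 + L)" using th q by (intro mult_left_mono) auto
      then have "?q * ln ?q - cond_ent K \<le> ?q * L"
        using cond_ent_ge_collision[of K] by (simp add: algebra_simps)
      also have "\<dots> \<le> ?q * (2 * ?q * L)" using q L by simp
      also have "\<dots> < ?q * (e * ln ?q)" using Lq q by (intro mult_strict_left_mono) auto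
      finally have "1 - cond_ent K / (?q * ln ?q) < e"
        using q lnq by (simp add: field_simps)
      then show ?thesis by (simp add: symmetric_capacity_pmf)
    next
      case False
      have "?q = collision K 0 + (\<Sum>d\<in>UNIV - {0}. collision K d)"
        unfolding sum_collision[of K, symmetric] by (rule sum.remove) auto
      also have "(\<Sum>d\<in>UNIV - {0}. collision K d) \<le> (\<Sum>d\<in>UNIV - {0 :: 'x}. L\<^sup>2)"
        using False by (intro sum_mono) auto
      also have "\<dots> \<le> (?q - 1) * L\<^sup>2" by (simp add: card_Diff_singleton of_nat_diff Suc_leI)
      also have "\<dots> \<le> ?q\<^sup>2 * L\<^sup>2" using q by (intro mult_right_mono) (auto simp: power2_eq_square intro: order_trans[of _ "?q * 1"])
      finally have "?q - collision K 0 \<le> ?q\<^sup>2 * L\<^sup>2" by simp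
      then have "(?q - collision K 0) / L \<le> ?q\<^sup>2 * L"
        using L by (simp add: power2_eq_square field_simps)
      then have "cond_ent K \<le> ?q * (2 * ?q * L)"
        using cond_ent_le_collision[OF L(1), of K] by (simp add: power2_eq_square algebra_simps)
      also have "\<dots> < ?q * (e * ln ?q)" using Lq q by (intro mult_strict_left_mono) auto
      finally have "cond_ent K / (?q * ln ?q) < e" using q lnq by (simp add: field_simps)
      then show ?thesis by (simp add: symmetric_capacity_pmf)
    qed
  qed (use th in simp)
qed

subsection \<open>The channel transform\<close>

lemma finite_card_lists_length:
  "finite {xs :: 'x::finite list. length xs = n}" "card {xs :: 'x list. length xs = n} = CARD('x) ^ n"
  using finite_lists_length_eq[of "UNIV :: 'x set" n] card_lists_length_eq[of "UNIV :: 'x set" n]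
  by simp_all

lemma lists_length_nonempty: "{xs :: 'x list. length xs = n} \<noteq> {}"
  by (auto intro: exI[of _ "replicate n undefined"])

text \<open>Sampling form of \<open>channel_transform\<close>: the later inputs \<open>vs\<close>
  are drawn and then forgotten. It makes normalisation automatic and lets degradations be computed
  with \<open>map_pmf\<close>. The default \<open>undefined\<close> lies outside the coordinates
  kept by \<open>map f [0..<l]\<close>.\<close>

definition transform_pmf ::
  "nat \<Rightarrow> ('x::finite list \<Rightarrow> 'x list) \<Rightarrow> nat \<Rightarrow> ('x \<Rightarrow> ('x, 'y) out_symbol pmf) \<Rightarrow> 'x \<Rightarrow> ('x, 'y) out_symbol pmf"
where
  "transform_pmf l g i K u =
     pmf_of_set {us. length us = i} \<bind> (\<lambda>us.
     pmf_of_set {vs. length vs = l - 1 - i} \<bind> (\<lambda>vs.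
     map_pmf (\<lambda>f. Obs (map f [0..<l]) us) (Pi_pmf {..<l} undefined (\<lambda>j. K (g (us @ u # vs) ! j)))))"

text \<open>Functions of positive probability equal \<open>undefined\<close> outside
  \<open>{..<l}\<close>, so up to probability zero the preimage of a symbol is the single function
  \<open>f0\<close>.\<close>

lemma pmf_map_Obs_Pi_pmf:
  "pmf (map_pmf (\<lambda>f. Obs (map f [0..<l]) us') (Pi_pmf {..<l} undefined p)) (Obs ys us) =
     (if length ys = l \<and> us' = us then \<Prod>j<l. pmf (p j) (ys ! j) else 0)"
proof (cases "length ys = l \<and> us' = us")
  case True
  define f0 where "f0 j = (if j < l then ys ! j else undefined)" for j
  have "pmf (map_pmf (\<lambda>f. Obs (map f [0..<l]) us') (Pi_pmf {..<l} undefined p)) (Obs ys us) =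
      measure (measure_pmf (Pi_pmf {..<l} undefined p)) ((\<lambda>f. Obs (map f [0..<l]) us') -` {Obs ys us})"
    by (rule pmf_map)
  also have "\<dots> = measure (measure_pmf (Pi_pmf {..<l} undefined p)) {f0}"
  proof (rule measure_prob_cong_0)
    fix f assume "f \<in> (\<lambda>f. Obs (map f [0..<l]) us') -` {Obs ys us} - {f0}"
    then have "ys = map f [0..<l]" "f \<noteq> f0" by auto
    then obtain m where "m \<notin> {..<l}" "f m \<noteq> undefined" by (auto simp: f0_def fun_eq_iff split: if_splits)
    then show "pmf (Pi_pmf {..<l} undefined p) f = 0" by (intro pmf_Pi_outside) auto
  next
    fix f assume "f \<in> {f0} - (\<lambda>f. Obs (map f [0..<l]) us') -` {Obs ys us}"
    then have "map f0 [0..<l] \<noteq> ys" using True by auto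
    moreover have "map f0 [0..<l] = ys" using True by (intro nth_equalityI) (auto simp: f0_def)
    ultimately show "pmf (Pi_pmf {..<l} undefined p) f = 0" by contradiction
  qed
  also have "\<dots> = (\<Prod>j<l. pmf (p j) (f0 j))"
    by (simp add: measure_pmf_single) (rule pmf_Pi', auto simp: f0_def)
  finally show ?thesis using True by (simp add: f0_def)
next
  case False
  then show ?thesis by (auto intro!: pmf_map_outside)
qed

lemma pmf_transform:
  fixes K :: "'x::finite \<Rightarrow> ('x, 'y) out_symbol pmf"
  assumes i: "i < l"
  shows "channel_transform l g i (\<lambda>x. pmf (K x)) = (\<lambda>u. pmf (transform_pmf l g i K u))"
proof (intro ext)
  fix u z
  note bind = pmf_bind_pmf_of_set[OF lists_length_nonempty finite_card_lists_length(1)]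
  show "channel_transform l g i (\<lambda>x. pmf (K x)) u z = pmf (transform_pmf l g i K u) z"
  proof (cases z)
    case (Sym y)
    have "Sym y \<notin> set_pmf (transform_pmf l g i K u)"
      unfolding transform_pmf_def set_bind_pmf set_map_pmf by blast
    then have "pmf (transform_pmf l g i K u) (Sym y) = 0" by (simp add: set_pmf_iff)
    with Sym show ?thesis by (simp add: channel_transform_def)
  next
    case (Obs ys us)
    let ?VS = "{vs :: 'x list. length vs = l - 1 - i}"
    define S where "S = (if length ys = l then
      (\<Sum>vs\<in>?VS. \<Prod>j<l. pmf (K (g (us @ u # vs) ! j)) (ys ! j)) else 0)"
    have inner: "pmf (pmf_of_set ?VS \<bind> (\<lambda>vs. map_pmf (\<lambda>f. Obs (map f [0..<l]) us')
        (Pi_pmf {..<l} undefined (\<lambda>j. K (g (us' @ u # vs) ! j))))) (Obs ys us) =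
      (if us' = us then S / real CARD('x) ^ (l - 1 - i) else 0)" for us'
      unfolding bind pmf_map_Obs_Pi_pmf finite_card_lists_length(2) S_def by simp
    have "pmf (transform_pmf l g i K u) z =
      (\<Sum>us'\<in>{us. length us = i}. if us' = us then S / real CARD('x) ^ (l - 1 - i) else 0)
        / real CARD('x) ^ i"
      unfolding transform_pmf_def bind[of i] Obs inner finite_card_lists_length(2) by simp
    also have "\<dots> = (if length us = i then S else 0)
        / (real CARD('x) ^ (l - 1 - i) * real CARD('x) ^ i)"
      by (simp add: finite_card_lists_length(1))
    \<comment> \<open>The uniform weights of the earlier and the later inputs combine;
      \<open>i < l\<close> makes the truncated subtraction exact.\<close>
    also have "real CARD('x) ^ (l - 1 - i) * real CARD('x) ^ i = real CARD('x) ^ (l - 1)"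
      using i by (subst power_add[symmetric]) simp
    finally show ?thesis
      unfolding Obs channel_transform_def S_def out_symbol.case
      by (cases "length us = i"; cases "length ys = l") simp_all
  qed
qed

text \<open>Makes the results on families of distributions available for every synthesised channel.
  Induction from the right matches \<open>fold\<close>, which applies the last index last.\<close>

lemma iterated_channel_pmf:
  fixes W :: "'x::finite \<Rightarrow> 'y pmf"
  assumes "set bs \<subseteq> {..<l}"
  shows "\<exists>K. iterated_channel l g W bs = (\<lambda>x. pmf (K x))"
  using assms
proof (induction bs rule: rev_induct)
  case Nil
  have "base_channel W x z = pmf (map_pmf Sym (W x)) z" for x z
    by (cases z) (auto simp: base_channel_def pmf_map_inj' inj_def pmf_eq_0_set_pmf)
  then have "base_channel W = (\<lambda>x. pmf (map_pmf Sym (W x)))" by (intro ext)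
  then show ?case by (auto simp: iterated_channel_def)
next
  case (snoc b bs)
  then obtain K where K: "iterated_channel l g W bs = (\<lambda>x. pmf (K x))" by auto
  have "iterated_channel l g W (bs @ [b]) = channel_transform l g b (iterated_channel l g W bs)"
    by (simp add: iterated_channel_def)
  also have "\<dots> = (\<lambda>u. pmf (transform_pmf l g b K u))"
    unfolding K using snoc.prems by (intro pmf_transform) simp
  finally show ?case by (intro exI[of _ "transform_pmf l g b K"])
qed

section \<open>Degrading the transformed channel to two looks\<close>

lemma map_pmf_Pi_pmf_pair:
  assumes A: "finite A" "k \<in> A" "j \<in> A" "j \<noteq> k"
  shows "map_pmf (\<lambda>f. (f k, f j)) (Pi_pmf A dflt p) = pair_pmf (p k) (p j)"
proof -
  have "A = insert k (A - {k})" using A by auto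
  then have "Pi_pmf A dflt p = map_pmf (\<lambda>(y, f). f(k := y)) (pair_pmf (p k) (Pi_pmf (A - {k}) dflt p))"
    using Pi_pmf_insert[of "A - {k}" k dflt p] A by simp
  then have "map_pmf (\<lambda>f. (f k, f j)) (Pi_pmf A dflt p) =
      map_pmf (apsnd (\<lambda>f. f j)) (pair_pmf (p k) (Pi_pmf (A - {k}) dflt p))"
    using A by (simp add: pmf.map_comp o_def case_prod_beta' apsnd_def map_prod_def)
  also have "\<dots> = pair_pmf (p k) (p j)"
    using A by (simp add: Pi_pmf_component flip: pair_map_pmf2)
  finally show ?thesis .
qed

text \<open>Adding \<open>t / w j\<close> to coordinate \<open>j\<close> permutes the vectors and
  adds \<open>t\<close> to the form. Its law is therefore translation invariant, hence
  uniform.\<close>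

lemma map_pmf_linear_form_uniform:
  fixes w :: "nat \<Rightarrow> 'x::{field, finite}"
  assumes j: "j < k" "w j \<noteq> 0"
  shows "map_pmf (\<lambda>us. \<Sum>i<k. w i * us ! i) (pmf_of_set {us. length us = k}) = pmf_of_set UNIV"
    (is "map_pmf ?c ?U = _")
proof -
  have shift: "map_pmf (\<lambda>x. x + t) (map_pmf ?c ?U) = map_pmf ?c ?U" for t
  proof -
    define b where "b us = us[j := us ! j + t / w j]" for us
    have "bij_betw b {us. length us = k} {us. length us = k}"
      by (rule bij_betw_byWitness[where f' = "\<lambda>us. us[j := us ! j - t / w j]"])
         (use j in \<open>auto simp: b_def\<close>)
    then have "map_pmf b ?U = ?U"
      by (intro map_pmf_of_set_bij_betw lists_length_nonempty finite_card_lists_length)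
    then have "map_pmf ?c ?U = map_pmf ?c (map_pmf b ?U)" by simp
    also have "\<dots> = map_pmf (\<lambda>us. ?c (b us)) ?U" by (simp only: pmf.map_comp o_def)
    also have "\<dots> = map_pmf (\<lambda>us. ?c us + t) ?U"
    proof (rule map_pmf_cong[OF refl])
      fix us assume "us \<in> set_pmf ?U"
      then have us: "length us = k"
        using set_pmf_of_set[OF lists_length_nonempty finite_card_lists_length(1)] by blast
      have "?c (b us) = w j * (us ! j + t / w j) + (\<Sum>i\<in>{..<k} - {j}. w i * us ! i)"
        using j us by (subst sum.remove[of _ j]) (auto simp: b_def intro!: sum.cong)
      also have "\<dots> = t + (w j * us ! j + (\<Sum>i\<in>{..<k} - {j}. w i * us ! i))"
        using j by (simp add: distrib_left)
      also have "\<dots> = ?c us + t" using j by (subst (2) sum.remove[of _ j]) auto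
      finally show "?c (b us) = ?c us + t" .
    qed
    finally show ?thesis unfolding pmf.map_comp o_def by (rule sym)
  qed
  have const: "pmf (map_pmf ?c ?U) t = pmf (map_pmf ?c ?U) 0" for t
    using pmf_map_inj'[of "\<lambda>x. x + t" "map_pmf ?c ?U" 0] unfolding shift by (simp add: inj_def)
  have "1 = (\<Sum>t\<in>UNIV. pmf (map_pmf ?c ?U) t)" by (rule sum_pmf_eq_1[symmetric]) auto
  also have "\<dots> = (\<Sum>t\<in>(UNIV :: 'x set). pmf (map_pmf ?c ?U) 0)" by (intro sum.cong refl const)
  finally have "pmf (map_pmf ?c ?U) 0 = 1 / real CARD('x)" by (simp add: field_simps)
  then show ?thesis
    by (intro pmf_eqI) (subst const, simp)
qed

lemma linear_kernel_nth:
  assumes "G \<in> carrier_mat l l" "length x = l" "m < l"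
  shows "linear_kernel G x ! m = (\<Sum>i<l. G $$ (i, m) * x ! i)"
  using assms
  by (auto simp: linear_kernel_def list_of_vec_index scalar_prod_def vec_of_list_index
      intro!: sum.cong)

text \<open>Keep only the outputs \<open>k\<close> and \<open>j\<close> and the combination
  \<open>c\<close> of known inputs. In column \<open>k\<close> only the diagonal entry survives, by
  triangularity above and \<open>rows\<close> below; in column \<open>j\<close> the rows after
  \<open>k\<close> vanish. So the two outputs see \<open>G $$ (k, k) * u\<close> and
  \<open>c us + G $$ (k, j) * u\<close>. The pad is uniform since \<open>G $$ (j, j)\<close> is
  nonzero, and data processing concludes.\<close>

lemma cond_ent_transform_le:
  fixes G :: "'x::{field, finite} mat" and K :: "'x \<Rightarrow> ('x, 'y) out_symbol pmf"
  assumes G: "G \<in> carrier_mat l l" and low: "lower_triangular G"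
    and rows: "\<And>i m. k < i \<Longrightarrow> i < l \<Longrightarrow> m < i \<Longrightarrow> G $$ (i, m) = 0"
    and k: "k < l" "G $$ (k, k) \<noteq> 0" and j: "j < k" "G $$ (j, j) \<noteq> 0"
  shows "cond_ent (transform_pmf l (linear_kernel G) k K) \<le>
    cond_ent (two_looks (G $$ (k, k)) (G $$ (k, j)) K)"
proof -
  let ?g = "linear_kernel G"
  define c where "c us = (\<Sum>i<k. G $$ (i, j) * us ! i)" for us
  define \<phi> where "\<phi> z = (case z of Obs ys us \<Rightarrow> (ys ! k, ys ! j, c us) | Sym y \<Rightarrow> undefined)"
    for z :: "('x, 'y) out_symbol"
  have jl: "j < l" using j k by simp
  have nth: "?g (us @ u # vs) ! k = G $$ (k, k) * u \<and> ?g (us @ u # vs) ! j = c us + G $$ (k, j) * u"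
    if us: "length us = k" and vs: "length vs = l - 1 - k" for us vs u
  proof -
    have len: "length (us @ u # vs) = l" using us vs k by simp
    have low0: "G $$ (i, m) = 0" if "i < m" "m < l" for i m
      using low G that by (auto simp: lower_triangular_def)
    have split: "(\<Sum>i<l. f i) = (\<Sum>i<k. f i) + f k" if "\<And>i. k < i \<Longrightarrow> i < l \<Longrightarrow> f i = 0"
      for f :: "nat \<Rightarrow> 'x"
    proof -
      have "(\<Sum>i<l. f i) = (\<Sum>i<Suc k. f i)"
        using k that by (intro sum.mono_neutral_right) auto
      then show ?thesis by simp
    qed
    have "?g (us @ u # vs) ! k = (\<Sum>i<k. G $$ (i, k) * (us @ u # vs) ! i) + G $$ (k, k) * u"
      unfolding linear_kernel_nth[OF G len k(1)] using us
      by (subst split) (auto simp: rows nth_append)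
    also have "(\<Sum>i<k. G $$ (i, k) * (us @ u # vs) ! i) = 0"
      by (intro sum.neutral) (use k low0 in auto)
    finally have 1: "?g (us @ u # vs) ! k = G $$ (k, k) * u" by simp
    have "?g (us @ u # vs) ! j = (\<Sum>i<k. G $$ (i, j) * (us @ u # vs) ! i) + G $$ (k, j) * u"
      unfolding linear_kernel_nth[OF G len jl] using us j
      by (subst split) (auto simp: rows nth_append)
    also have "(\<Sum>i<k. G $$ (i, j) * (us @ u # vs) ! i) = c us"
      unfolding c_def using us by (intro sum.cong) (auto simp: nth_append)
    finally show ?thesis using 1 by simp
  qed
  note set_lists = set_pmf_of_set[OF lists_length_nonempty finite_card_lists_length(1)]
  let ?F = "\<lambda>u c. map_pmf (\<lambda>(y, y'). (y, y', c))
    (pair_pmf (K (G $$ (k, k) * u)) (K (c + G $$ (k, j) * u)))"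
  have "map_pmf \<phi> (transform_pmf l ?g k K u) = two_looks (G $$ (k, k)) (G $$ (k, j)) K u" for u
  proof -
    have inner: "map_pmf \<phi> (map_pmf (\<lambda>f. Obs (map f [0..<l]) us)
        (Pi_pmf {..<l} undefined (\<lambda>m. K (?g (us @ u # vs) ! m)))) = ?F u (c us)"
      if "length us = k" "length vs = l - 1 - k" for us vs
    proof -
      have "map_pmf \<phi> (map_pmf (\<lambda>f. Obs (map f [0..<l]) us)
          (Pi_pmf {..<l} undefined (\<lambda>m. K (?g (us @ u # vs) ! m)))) =
        map_pmf (\<lambda>(y, y'). (y, y', c us)) (map_pmf (\<lambda>f. (f k, f j))
          (Pi_pmf {..<l} undefined (\<lambda>m. K (?g (us @ u # vs) ! m))))"
        using k jl by (simp add: pmf.map_comp o_def \<phi>_def)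
      also have "map_pmf (\<lambda>f. (f k, f j)) (Pi_pmf {..<l} undefined (\<lambda>m. K (?g (us @ u # vs) ! m))) =
          pair_pmf (K (G $$ (k, k) * u)) (K (c us + G $$ (k, j) * u))"
        using k j jl nth[OF that] by (subst map_pmf_Pi_pmf_pair) auto
      finally show ?thesis .
    qed
    have "map_pmf \<phi> (transform_pmf l ?g k K u) =
        pmf_of_set {us. length us = k} \<bind> (\<lambda>us. pmf_of_set {vs :: 'x list. length vs = l - 1 - k} \<bind> (\<lambda>vs. ?F u (c us)))"
      unfolding transform_pmf_def map_bind_pmf
    proof (intro bind_pmf_cong refl)
      fix us vs :: "'x list"
      assume "us \<in> set_pmf (pmf_of_set {us. length us = k})" "vs \<in> set_pmf (pmf_of_set {vs. length vs = l - 1 - k})"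
      then have "length us = k" "length vs = l - 1 - k" unfolding set_lists by blast+
      then show "map_pmf \<phi> (map_pmf (\<lambda>f. Obs (map f [0..<l]) us)
        (Pi_pmf {..<l} undefined (\<lambda>m. K (?g (us @ u # vs) ! m)))) = ?F u (c us)" by (rule inner)
    qed
    \<comment> \<open>The pad does not depend on \<open>vs\<close>, so averaging over the later
      inputs has no effect.\<close>
    also have "\<dots> = map_pmf c (pmf_of_set {us. length us = k}) \<bind> ?F u"
      by (simp only: bind_pmf_const bind_map_pmf)
    also have "map_pmf c (pmf_of_set {us. length us = k}) = pmf_of_set UNIV"
      unfolding c_def by (rule map_pmf_linear_form_uniform) (rule j)+
    finally show ?thesis by (simp add: two_looks_def)
  qed
  with cond_ent_map_le[of "transform_pmf l ?g k K" \<phi>] show ?thesis by simp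
qed

section \<open>Structure of the kernel matrix\<close>

lemma lower_triangular_diag_nonzero:
  fixes G :: "'x::field mat"
  assumes G: "G \<in> carrier_mat l l" and rank: "vec_space.rank l G = l"
    and low: "lower_triangular G" and i: "i < l"
  shows "G $$ (i, i) \<noteq> 0"
proof -
  have "G $$ (i, j) = 0" if "i < j" "j < l" for i j
    using low G that by (auto simp: lower_triangular_def)
  then have "det G = prod_list (diag_mat G)"
    using G by (rule det_lower_triangular)
  moreover have "det G \<noteq> 0"
    using vec_space.det_rank_iff[OF G] rank by blast
  ultimately have "0 \<notin> set (diag_mat G)"
    by (simp only: prod_list_zero_iff not_False_eq_True)
  moreover have "G $$ (i, i) \<in> set (diag_mat G)"
    using G i by (simp add: diag_mat_def)
  ultimately show ?thesis by metis
qed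

text \<open>As the diagonal is nonzero, any nonzero off-diagonal entry gives its row at least two
  nonzero entries. Hence the set under \<open>Max\<close> is nonempty, and rows beyond its maximum
  have no such entry.\<close>

lemma last_nondiagonal_row:
  fixes G :: "'x::field mat"
  assumes G: "G \<in> carrier_mat l l" and diag: "\<And>i. i < l \<Longrightarrow> G $$ (i, i) \<noteq> 0"
    and not_diagonal: "\<not> diagonal_mat G"
    and k: "k = Max {i. i < l \<and> card {j. j < l \<and> G $$ (i, j) \<noteq> 0} > 1}"
  shows "k < l" and "\<And>i m. k < i \<Longrightarrow> i < l \<Longrightarrow> m < i \<Longrightarrow> G $$ (i, m) = 0"
proof -
  define R where "R = {i. i < l \<and> card {j. j < l \<and> G $$ (i, j) \<noteq> 0} > 1}"
  have "finite R" by (simp add: R_def)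
  have R_I: "i \<in> R" if "i < l" "j < l" "j \<noteq> i" "G $$ (i, j) \<noteq> 0" for i j
  proof -
    have "card {i, j} \<le> card {j. j < l \<and> G $$ (i, j) \<noteq> 0}"
      using that diag[OF that(1)] by (intro card_mono) auto
    with that show ?thesis by (simp add: R_def)
  qed
  obtain i j where "i < l" "j < l" "i \<noteq> j" "G $$ (i, j) \<noteq> 0"
    using not_diagonal G by (auto simp: diagonal_mat_def)
  then have "R \<noteq> {}" using R_I[of i j] by auto
  with \<open>finite R\<close> have "k \<in> R" unfolding k R_def[symmetric] by (rule Max_in)
  then show "k < l" by (simp add: R_def)
  fix i m
  assume im: "k < i" "i < l" "m < i"
  show "G $$ (i, m) = 0"
  proof (rule ccontr)
    assume "G $$ (i, m) \<noteq> 0"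
    then have "i \<in> R" using R_I[of i m] im by simp
    then have "i \<le> k" unfolding k R_def[symmetric] by (rule Max_ge[OF \<open>finite R\<close>])
    with im show False by simp
  qed
qed

subsection \<open>Polarization\<close>

text \<open>The point is that \<open>\<eta>\<close> is uniform over all channels, since the channel
  changes at every step of the process.\<close>

lemma capacity_gain_polarizes:
  fixes G :: "'x::{field, finite} mat"
  assumes G: "G \<in> carrier_mat l l" and low: "lower_triangular G"
    and rows: "\<And>i m. k < i \<Longrightarrow> i < l \<Longrightarrow> m < i \<Longrightarrow> G $$ (i, m) = 0"
    and k: "k < l" "G $$ (k, k) \<noteq> 0" and j: "j < k" "G $$ (j, j) \<noteq> 0"
    and prim: "primitive_element (G $$ (k, j) / G $$ (k, k))" and e: "0 < e"
  shows "\<exists>\<eta>>0. \<forall>V :: ('x, 'y) channel. (\<exists>K. V = (\<lambda>x. pmf (K x))) \<longrightarrow>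
    symmetric_capacity (channel_transform l (linear_kernel G) k V) - symmetric_capacity V < \<eta> \<longrightarrow>
    symmetric_capacity V < e \<or> 1 - e < symmetric_capacity V"
proof -
  let ?q = "real CARD('x)" and ?g = "linear_kernel G"
  let ?gk = "G $$ (k, k)" and ?h = "G $$ (k, j)"
  have q: "1 < ?q" using two_le_card_field[where 'x = 'x] by linarith
  then have lnq: "0 < ln ?q" by simp
  then have D: "0 < ?q * ln ?q" using q by simp
  obtain \<delta> where \<delta>: "0 < \<delta>" "\<And>K :: 'x \<Rightarrow> ('x, 'y) out_symbol pmf.
    (\<And>d. d \<noteq> 0 \<Longrightarrow> collision K d * (collision K 0 - collision K (?h / ?gk * d)) \<le> \<delta>) \<Longrightarrow>
    symmetric_capacity (\<lambda>x. pmf (K x)) < e \<or> 1 - e < symmetric_capacity (\<lambda>x. pmf (K x))"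
    using capacity_dichotomy[OF prim e, where 'o = "('x, 'y) out_symbol"] by blast
  show ?thesis
  \<comment> \<open>The factor \<open>4 * q\<close> comes from \<open>cond_ent_two_looks\<close>,
    and \<open>q * ln q\<close> from normalising the capacity.\<close>
  proof (intro exI[of _ "\<delta> / (4 * ?q * (?q * ln ?q))"] conjI allI impI)
    show "0 < \<delta> / (4 * ?q * (?q * ln ?q))" using \<delta> q lnq by simp
  next
    fix V :: "('x, 'y) channel"
    assume "\<exists>K. V = (\<lambda>x. pmf (K x))"
      and diff: "symmetric_capacity (channel_transform l ?g k V) - symmetric_capacity V
        < \<delta> / (4 * ?q * (?q * ln ?q))"
    then obtain K where V: "V = (\<lambda>x. pmf (K x))" by blast
    have "(cond_ent K - cond_ent (transform_pmf l ?g k K)) / (?q * ln ?q) < \<delta> / (4 * ?q * (?q * ln ?q))"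
      using diff unfolding V pmf_transform[OF k(1)] symmetric_capacity_pmf
      by (simp add: diff_divide_distrib)
    then have "(cond_ent K - cond_ent (transform_pmf l ?g k K)) / (?q * ln ?q) * (4 * ?q * (?q * ln ?q)) < \<delta>"
      using q D by (subst (asm) pos_less_divide_eq) auto
    moreover have "a / D * (c * D) = c * a" if "0 < D" for a c D :: real
      using that by simp
    from this[of "?q * ln ?q", OF D] have "(cond_ent K - cond_ent (transform_pmf l ?g k K)) / (?q * ln ?q)
        * (4 * ?q * (?q * ln ?q)) = 4 * ?q * (cond_ent K - cond_ent (transform_pmf l ?g k K))"
      .
    ultimately have small: "4 * ?q * (cond_ent K - cond_ent (transform_pmf l ?g k K)) < \<delta>"
      by (simp only:)
    have "collision K d * (collision K 0 - collision K (?h / ?gk * d)) \<le> \<delta>" for d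
    proof -
      have "collision K d * (collision K 0 - collision K (?h / ?gk * d)) / (4 * ?q) \<le>
          cond_ent K - cond_ent (transform_pmf l ?g k K)"
        \<comment> \<open>Taking the shift \<open>d / G $$ (k, k)\<close> turns the two collision
          arguments into \<open>d\<close> and \<open>G $$ (k, j) / G $$ (k, k) * d\<close>.\<close>
        using cond_ent_two_looks[OF k(2), of ?h K "d / ?gk"]
          cond_ent_transform_le[OF G low rows k j, of K] k(2) by simp
      then have "collision K d * (collision K 0 - collision K (?h / ?gk * d)) \<le>
          4 * ?q * (cond_ent K - cond_ent (transform_pmf l ?g k K))"
        using q by (simp add: pos_divide_le_eq mult.commute)
      with small show ?thesis by linarith
    qed
    then show "symmetric_capacity V < e \<or> 1 - e < symmetric_capacity V"
      unfolding V by (rule \<delta>(2))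
  qed
qed

text \<open>The limsup of the events has probability at least \<open>1 / l\<close>, because every
  tail union contains an event of that probability. By independence and the Borel 0-1 law the
  probability is then 1.\<close>

lemma (in prob_space) AE_infinitely_often_uniform:
  assumes B_indep: "indep_vars (\<lambda>_. count_space {..<l}) B {1..}"
    and B_uniform: "\<And>n. n \<ge> 1 \<Longrightarrow> distr M (count_space {..<l}) (B n) = uniform_count_measure {..<l}"
    and k: "k < (l :: nat)"
  shows "AE \<omega> in M. infinite {n :: nat. B (Suc n) \<omega> = k}"
proof -
  define F where "F n = B (Suc n) -` {k} \<inter> space M" for n
  have rv: "B (Suc n) \<in> measurable M (count_space {..<l})" for n
    using B_indep by (auto simp: indep_vars_def)
  have F[measurable]: "F n \<in> events" for n
    unfolding F_def using k by (intro measurable_sets[OF rv]) auto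
  have prob_F: "prob (F n) = 1 / l" for n
  proof -
    have "prob (F n) = measure (distr M (count_space {..<l}) (B (Suc n))) {k}"
      unfolding F_def using k by (subst measure_distr[OF rv]) auto
    also have "\<dots> = 1 / l" using k by (simp add: B_uniform measure_uniform_count_measure)
    finally show ?thesis .
  qed
  have "indep_events F UNIV"
  proof (rule indep_eventsI)
    fix J :: "nat set" assume J: "finite J" "J \<noteq> {}"
    have "prob (\<Inter>i\<in>Suc ` J. B i -` {k} \<inter> space M) = (\<Prod>i\<in>Suc ` J. prob (B i -` {k} \<inter> space M))"
      using J k by (intro indep_varsD[OF B_indep]) auto
    then show "prob (\<Inter>i\<in>J. F i) = (\<Prod>i\<in>J. prob (F i))"
      by (simp only: F_def image_image prod.reindex[OF inj_Suc] o_def)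
  qed (rule F)
  then have zero_one: "prob (\<Inter>n. \<Union>m\<in>{n..}. F m) = 0 \<or> prob (\<Inter>n. \<Union>m\<in>{n..}. F m) = 1"
    by (rule borel_0_1_law)
  have "(\<lambda>n. prob (\<Union>m\<in>{n..}. F m)) \<longlonglongrightarrow> prob (\<Inter>n. \<Union>m\<in>{n..}. F m)"
  proof (rule finite_Lim_measure_decseq)
    show "decseq (\<lambda>n. \<Union>m\<in>{n..}. F m)" unfolding decseq_def by (intro allI impI UN_mono) auto
  qed auto
  moreover have "1 / l \<le> prob (\<Union>m\<in>{n..}. F m)" for n
    unfolding prob_F[of n, symmetric] by (rule finite_measure_mono) auto
  ultimately have "1 / l \<le> prob (\<Inter>n. \<Union>m\<in>{n..}. F m)"
    by (intro LIMSEQ_le_const) auto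
  moreover have "0 < 1 / real l" using k by simp
  ultimately have "prob (\<Inter>n. \<Union>m\<in>{n..}. F m) = 1" using zero_one by linarith
  then have "AE \<omega> in M. \<omega> \<in> (\<Inter>n. \<Union>m\<in>{n..}. F m)"
    by (subst (asm) prob_eq_1) auto
  then show ?thesis
    by (rule AE_mp) (auto simp: F_def infinite_nat_iff_unbounded_le intro!: AE_I2)
qed

theorem corollary5p13:
  fixes W :: "'x::{field, finite} \<Rightarrow> 'y::countable pmf"
    and G :: "'x mat"
    and l k :: nat
    and M :: "'a measure"
    and B :: "nat \<Rightarrow> 'a \<Rightarrow> nat"
    and I_inf :: "'a \<Rightarrow> real"
  assumes G: "G \<in> carrier_mat l l"
    and full_rank: "vec_space.rank l G = l"
    and lower: "lower_triangular G"
    and not_diagonal: "\<not> diagonal_mat G"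
    and k: "k = Max {i. i < l \<and> card {j. j < l \<and> G $$ (i, j) \<noteq> 0} > 1}"
    and primitive: "\<exists>j<k. primitive_element (G $$ (k, j) / G $$ (k, k))"
    and M: "prob_space M"
    and B_indep: "prob_space.indep_vars M (\<lambda>_. count_space {..<l}) B {1..}"
    and B_uniform: "\<And>n. n \<ge> 1 \<Longrightarrow>
      distr M (count_space {..<l}) (B n) = uniform_count_measure {..<l}"
    and I_inf_measurable: "I_inf \<in> borel_measurable M"
    and I_inf_limit: "AE \<omega> in M.
      (\<lambda>n. symmetric_capacity (iterated_channel l (linear_kernel G) W (map (\<lambda>m. B m \<omega>) [1..<Suc n])))
        \<longlonglongrightarrow> I_inf \<omega>"
  shows "prob_space.prob M {\<omega> \<in> space M. I_inf \<omega> \<in> {0, 1}} = 1"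
proof -
  interpret prob_space M by (rule M)
  let ?g = "linear_kernel G"
  note diag = lower_triangular_diag_nonzero[OF G full_rank lower]
  have kl: "k < l"
    using G diag not_diagonal k by (rule last_nondiagonal_row)
  have rows: "G $$ (i, m) = 0" if "k < i" "i < l" "m < i" for i m
    using that by (intro last_nondiagonal_row(2)[OF G diag not_diagonal k])
  obtain j where j: "j < k" and prim: "primitive_element (G $$ (k, j) / G $$ (k, k))"
    using primitive by blast
  have jj: "G $$ (j, j) \<noteq> 0" using diag j kl by simp

  define V where "V n \<omega> = iterated_channel l ?g W (map (\<lambda>m. B m \<omega>) [1..<Suc n])" for n \<omega>
  have limit: "I_inf \<omega> \<in> {0, 1}"
    if \<omega>: "\<omega> \<in> space M" and often: "infinite {n. B (Suc n) \<omega> = k}"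
      and lim: "(\<lambda>n. symmetric_capacity (V n \<omega>)) \<longlonglongrightarrow> I_inf \<omega>" for \<omega>
  proof (rule ccontr)
    assume "I_inf \<omega> \<notin> {0, 1}"
    have B_less: "B n \<omega> < l" if "n \<ge> 1" for n
    proof -
      have "B n \<in> measurable M (count_space {..<l})"
        using B_indep that by (auto simp: indep_vars_def)
      from measurable_space[OF this \<omega>] show ?thesis by simp
    qed
    have V_pmf: "\<exists>K. V n \<omega> = (\<lambda>x. pmf (K x))" for n
      unfolding V_def by (rule iterated_channel_pmf) (auto simp: B_less)
    have "0 \<le> symmetric_capacity (V n \<omega>) \<and> symmetric_capacity (V n \<omega>) \<le> 1" for n
      using V_pmf[of n] symmetric_capacity_bounds by auto
    then have "0 \<le> I_inf \<omega>" "I_inf \<omega> \<le> 1"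
      using LIMSEQ_le_const[OF lim, of 0] LIMSEQ_le_const2[OF lim, of 1] by auto
    \<comment> \<open>Half the distance from the limit to 0 and 1, so a capacity within
      \<open>e\<close> of the limit lies in the interval from \<open>e\<close> to
      \<open>1 - e\<close>.\<close>
    define e where "e = min (I_inf \<omega>) (1 - I_inf \<omega>) / 2"
    have e: "0 < e" "2 * e \<le> I_inf \<omega>" "2 * e \<le> 1 - I_inf \<omega>"
      using \<open>I_inf \<omega> \<notin> {0, 1}\<close> \<open>0 \<le> I_inf \<omega>\<close> \<open>I_inf \<omega> \<le> 1\<close> by (auto simp: e_def)
    obtain \<eta> where \<eta>: "0 < \<eta>" and polarizes: "\<And>V :: ('x, 'y) channel. \<exists>K. V = (\<lambda>x. pmf (K x)) \<Longrightarrow>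
      symmetric_capacity (channel_transform l ?g k V) - symmetric_capacity V < \<eta> \<Longrightarrow>
      symmetric_capacity V < e \<or> 1 - e < symmetric_capacity V"
      using capacity_gain_polarizes[OF G lower rows kl diag[OF kl] j jj prim e(1)] by blast
    \<comment> \<open>Closeness \<open>e\<close> keeps the capacity away from 0 and 1; closeness
      \<open>\<eta> / 2\<close> at two consecutive times keeps the gain below
      \<open>\<eta>\<close>.\<close>
    have "0 < min e (\<eta> / 2)" using e \<eta> by simp
    from LIMSEQ_D[OF lim this] obtain N where
      N: "\<And>n. N \<le> n \<Longrightarrow> \<bar>symmetric_capacity (V n \<omega>) - I_inf \<omega>\<bar> < min e (\<eta> / 2)"
      by auto
    obtain n where n: "N \<le> n" "B (Suc n) \<omega> = k"
      using often by (auto simp: infinite_nat_iff_unbounded_le)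
    \<comment> \<open>The index \<open>B (Suc n) \<omega>\<close> is the last in the list, so its
      transform is the outermost one.\<close>
    have "V (Suc n) \<omega> = channel_transform l ?g k (V n \<omega>)"
      using n(2) by (simp add: V_def iterated_channel_def)
    moreover have "\<bar>symmetric_capacity (V n \<omega>) - I_inf \<omega>\<bar> < \<eta> / 2"
      "\<bar>symmetric_capacity (V (Suc n) \<omega>) - I_inf \<omega>\<bar> < \<eta> / 2"
      using N[of n] N[of "Suc n"] n(1) by auto
    ultimately have "symmetric_capacity (channel_transform l ?g k (V n \<omega>))
        - symmetric_capacity (V n \<omega>) < \<eta>"
      by (simp only: abs_less_iff) linarith
    from polarizes[OF V_pmf this] N[OF n(1)] e show False by (auto simp: abs_less_iff)
  qed
  have "AE \<omega> in M. infinite {n. B (Suc n) \<omega> = k}"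
    using B_indep B_uniform kl by (rule AE_infinitely_often_uniform)
  then have "AE \<omega> in M. I_inf \<omega> \<in> {0, 1}"
    using I_inf_limit AE_space
  proof eventually_elim
    case (elim \<omega>)
    from limit[OF elim(3,1) elim(2)[folded V_def]] show ?case .
  qed
  moreover have "{\<omega> \<in> space M. I_inf \<omega> \<in> {0, 1}} \<in> events"
    using I_inf_measurable by measurable
  ultimately show ?thesis by (simp add: prob_Collect_eq_1)
qed

end
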